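(* Let $(A,\alpha,\mathfrak u)$ and $(B,\beta,\mathfrak v)$ be anomalous actions of a finite group $G$ on separable C$^*$-algebras such that $(B,\beta,\mathfrak v)$ has the Rokhlin property. Let $\phi,\psi:(A,\alpha,\mathfrak u)\to(B,\beta,\mathfrak v)$ be two $G$-coherent morphisms. If $\phi_1\approx_{\mathrm{MvN}}\psi_1$, then $\phi\approx_{\mathrm{MvN}}^G\psi$.
   Context: $\mathcal M(A)$ is the multiplier algebra of $A$. An anomalous action $(A,\alpha,\mathfrak u)$ of a discrete group $G$ consists of maps $\alpha:G\to\mathrm{Aut}(A)$, $\mathfrak u:G\times G\to\mathcal U(\mathcal M(A))$ such that for all $g,h,k\in G$: $\alpha_g\alpha_h=\mathrm{Ad}(\mathfrak u_{g,h})\alpha_{gh}$; $\alpha_g(\mathfrak u_{h,k})\mathfrak u_{g,hk}\mathfrak u_{gh,k}^*\mathfrak u_{g,h}^*\in\mathbb T\mathbf 1_{\mathcal M(A)}$ (this defines the anomaly, a normalised 3-cocycle in $Z^3(G,\mathbb T)$; the two anomalous actions between which equivalences of $G$-coherent morphisms are considered have the same anomaly); $\mathfrak u_{g,1}=\mathfrak u_{1,g}=\mathbf 1$. A $G$-coherent morphism $\phi:(A,\alpha,\mathfrak u)\to(B,\beta,\mathfrak v)$ is a tuple of linear maps $(\phi_g:A\to B)_{g\in G}$ with $\phi_g(a)^*\phi_g(b)=\phi_1(a^*b)$ and $\phi_{gh}(\mathfrak u_{g,h}^*\alpha_g(a)b)=\mathfrak v_{g,h}^*\beta_g(\phi_h(a))\phi_g(b)$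 for all $g,h\in G$, $a,b\in A$. (Then $\phi_1$ is a $*$-homomorphism.) Rokhlin property (for $G$ finite, $B$ separable): with $B_\infty=\ell^\infty(\mathbb N,B)/c_0(\mathbb N,B)$ and $F_\infty(B)=(B_\infty\cap B')/(B_\infty\cap B^\perp)$, where $B_\infty\cap B^\perp=\{x\in B_\infty:xb=bx=0\ \forall b\in B\}$, the maps $\beta_g$ induce an action of $G$ on the unital C$^*$-algebra $F_\infty(B)$; $(B,\beta,\mathfrak v)$ has the Rokhlin property if there is a projection $p\in F_\infty(B)$ with $\sum_{g\in G}\beta_g(p)=\mathbf 1$. Two $G$-coherent morphisms $\phi,\psi:(A,\alpha,\mathfrak u)\to(B,\beta,\mathfrak v)$ are approximately Murray--von Neumann equivalent, $\phi\approx^G_{\mathrm{MvN}}\psi$, if for all $\varepsilon>0$ and finite sets $K\subset G$, $F\subset A$ there is $v\in B$ with $\|\beta_g(v^* )\phi_g(a)v-\psi_g(a)\|<\varepsilon$ and $\|\beta_g(v)\psi_g(a)v^*-\phi_g(a)\|<\varepsilon$ for all $g\in K$, $a\in F$. For $*$-homomorphisms $\phi_1,\psi_1:A\to B$, $\phi_1\approx_{\mathrm{MvN}}\psi_1$ is the case of the trivial group: for all $\varepsilon>0$ and finite $F\subset A$ there is $v\in B$ with $\|v^*\phi_1(a)v-\psi_1(a)\|<\varepsilon$ and $\|v\psi_1(a)v^*-\phi_1(a)\|<\varepsilon$ for $a\in F$. *)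

theory Defs
  imports "HOL-Analysis.Analysis" "HOL-Algebra.Group"
begin

section \<open>C*-algebras\<close>

class scaleC =
  fixes scaleC :: "complex \<Rightarrow> 'a \<Rightarrow> 'a" (infixr \<open>*\<^sub>C\<close> 75)

class star =
  fixes star :: "'a \<Rightarrow> 'a"

class complex_star_algebra = ring + scaleC + star +
  assumes scaleC_add_right: "c *\<^sub>C (x + y) = c *\<^sub>C x + c *\<^sub>C y"
    and scaleC_add_left: "(c + d) *\<^sub>C x = c *\<^sub>C x + d *\<^sub>C x"
    and scaleC_scaleC: "c *\<^sub>C d *\<^sub>C x = (c * d) *\<^sub>C x"
    and scaleC_one: "1 *\<^sub>C x = x"
    and mult_scaleC_left: "(c *\<^sub>C x) * y = c *\<^sub>C (x * y)"
    and mult_scaleC_right: "x * (c *\<^sub>C y) = c *\<^sub>C (x * y)"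
    and star_add: "star (x + y) = star x + star y"
    and star_scaleC: "star (c *\<^sub>C x) = cnj c *\<^sub>C star x"
    and star_star: "star (star x) = x"
    and star_mult: "star (x * y) = star y * star x"

text \<open>No unit is required, and the zero algebra is allowed.\<close>

class cstar_algebra = complex_star_algebra + real_normed_algebra + banach +
  assumes scaleR_scaleC: "r *\<^sub>R x = complex_of_real r *\<^sub>C x"
    and norm_scaleC: "norm (c *\<^sub>C x) = cmod c * norm x"
    and cstar_identity: "norm (star x * x) = (norm x)\<^sup>2"

instantiation complex :: cstar_algebra
begin

definition scaleC_complex :: "complex \<Rightarrow> complex \<Rightarrow> complex"
  where "scaleC_complex c x = c * x"

definition star_complex :: "complex \<Rightarrow> complex"
  where "star_complex = cnj"

instance
  by standard (simp_all add: scaleC_complex_def star_complex_def algebra_simps norm_mult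
      scaleR_conv_of_real power2_eq_square)

end

definition clinear :: "('a::complex_star_algebra \<Rightarrow> 'b::complex_star_algebra) \<Rightarrow> bool"
  where "clinear f \<longleftrightarrow> Vector_Spaces.linear scaleC scaleC f"

definition star_hom :: "('a::complex_star_algebra \<Rightarrow> 'b::complex_star_algebra) \<Rightarrow> bool"
  where "star_hom f \<longleftrightarrow> clinear f \<and> (\<forall>x y. f (x * y) = f x * f y) \<and> (\<forall>x. f (star x) = star (f x))"

definition projection :: "'a::complex_star_algebra \<Rightarrow> bool"
  where "projection p \<longleftrightarrow> star p = p \<and> p * p = p"

text \<open>
  The equation \<open>e = 1\<close>. It is used for the central sequence algebra below, which has a unit
  (the class of an approximate unit) when the coefficient algebra is separable, but not
  uniformly for all types of the class.
\<close>

definition is_unit_element :: "'a::complex_star_algebra \<Rightarrow> bool"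
  where "is_unit_element e \<longleftrightarrow> (\<forall>x. e * x = x \<and> x * e = x)"

definition unitary :: "'a::{complex_star_algebra, monoid_mult} \<Rightarrow> bool"
  where "unitary u \<longleftrightarrow> star u * u = 1 \<and> u * star u = 1"

lemma vector_space_scaleC: "vector_space (scaleC :: complex \<Rightarrow> 'a::complex_star_algebra \<Rightarrow> 'a)"
  by unfold_locales (simp_all add: scaleC_add_right scaleC_add_left scaleC_scaleC scaleC_one)

lemma clinear_iff:
  "clinear f \<longleftrightarrow> (\<forall>x y. f (x + y) = f x + f y) \<and> (\<forall>c x. f (c *\<^sub>C x) = c *\<^sub>C f x)"
  unfolding clinear_def Vector_Spaces.linear_iff by (simp add: vector_space_scaleC)

lemma scaleC_zero_right [simp]: "c *\<^sub>C (0::'a::complex_star_algebra) = 0"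
  using scaleC_add_right[of c "0::'a" 0] by simp

lemma scaleC_zero_left [simp]: "0 *\<^sub>C (x::'a::complex_star_algebra) = 0"
  using scaleC_add_left[of 0 0 x] by simp

lemma scaleC_minus_right: "c *\<^sub>C (- x) = - (c *\<^sub>C (x::'a::complex_star_algebra))"
  using scaleC_add_right[of c x "- x"] by (simp add: eq_neg_iff_add_eq_0 add.commute)

lemma scaleC_diff_right: "c *\<^sub>C (x - y) = c *\<^sub>C x - c *\<^sub>C (y::'a::complex_star_algebra)"
  using scaleC_add_right[of c x "- y"] by (simp add: scaleC_minus_right)

lemma star_zero [simp]: "star (0::'a::complex_star_algebra) = 0"
  using star_add[of "0::'a" 0] by simp

lemma star_minus: "star (- x) = - star (x::'a::complex_star_algebra)"
  using star_add[of x "- x"] by (simp add: eq_neg_iff_add_eq_0 add.commute)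

lemma star_diff: "star (x - y) = star x - star (y::'a::complex_star_algebra)"
  using star_add[of x "- y"] by (simp add: star_minus)

lemma clinear_add: "clinear f \<Longrightarrow> f (x + y) = f x + f y"
  and clinear_scaleC: "clinear f \<Longrightarrow> f (c *\<^sub>C x) = c *\<^sub>C f x"
  by (simp_all add: clinear_iff)

lemma clinear_zero: "clinear f \<Longrightarrow> f 0 = 0"
  using clinear_add[of f 0 0] by simp

lemma clinear_minus: "clinear f \<Longrightarrow> f (- x) = - f x"
  using clinear_add[of f x "- x"] by (simp add: clinear_zero eq_neg_iff_add_eq_0 add.commute)

lemma clinear_diff: "clinear f \<Longrightarrow> f (x - y) = f x - f y"
  using clinear_add[of f x "- y"] by (simp add: clinear_minus)

lemma norm_star: "norm (star x) = norm (x::'a::cstar_algebra)"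
proof -
  have *: "norm y \<le> norm (star y)" for y :: 'a
  proof (cases "y = 0")
    case False
    have "norm y * norm y \<le> norm (star y) * norm y"
      using norm_mult_ineq[of "star y" y] by (simp add: cstar_identity power2_eq_square)
    then show ?thesis using False by simp
  qed simp
  show ?thesis using *[of x] *[of "star x"] by (simp add: star_star)
qed

lemma bounded_linear_star: "bounded_linear (star :: 'a::cstar_algebra \<Rightarrow> 'a)"
  by (rule bounded_linear_intro[where K = 1])
     (simp_all add: star_add scaleR_scaleC star_scaleC norm_star)

lemma bounded_linear_scaleC: "bounded_linear (scaleC c :: 'a::cstar_algebra \<Rightarrow> 'a)"
  by (rule bounded_linear_intro[where K = "cmod c"])
     (simp_all add: scaleC_add_right scaleR_scaleC scaleC_scaleC norm_scaleC mult.commute)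

subsection \<open>Automatic continuity\<close>

text \<open>
  A *-homomorphism is contractive. If \<open>x\<close> is self-adjoint with \<open>norm x < 1\<close>, there is a
  self-adjoint \<open>y\<close> commuting with \<open>x\<close> such that \<open>x\<^sup>2 + (1 - y)\<^sup>2 = 1\<close>; hence \<open>x + \<i> (1 - y)\<close>
  is unitary in the unitization, and so is its image.
\<close>

lemma unitary_partner:
  fixes x :: "'a::cstar_algebra"
  assumes sa: "star x = x" and less: "norm x < 1"
  obtains y where "star y = y" "x * y = y * x" "y + y = x * x + y * y"
proof -
  let ?S = "{y. star y = y} \<inter> {y. x * y = y * x} \<inter> cball 0 (norm x)"
  let ?T = "\<lambda>y. (1/2) *\<^sub>R (x * x + y * y)"
  have cont: "continuous_on UNIV (star :: 'a \<Rightarrow> 'a)"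
    using bounded_linear_star linear_continuous_on by blast
  have "closed ?S"
    by (intro closed_Int closed_Collect_eq closed_cball continuous_intros cont)
  then have 1: "complete ?S" by (simp add: complete_eq_closed)
  have "0 \<in> ?S" by simp
  then have 2: "?S \<noteq> {}" by blast
  have 3: "?T ` ?S \<subseteq> ?S"
  proof safe
    fix y assume y: "star y = y" "x * y = y * x" "y \<in> cball 0 (norm x)"
    show "star (?T y) = ?T y"
      using sa y by (simp add: scaleR_scaleC star_scaleC star_add star_mult)
    have "x * (y * y) = y * y * x" using y(2) by (metis mult.assoc)
    then show "x * ?T y = ?T y * x" by (simp add: distrib_left distrib_right mult.assoc)
    have "norm (y * y) \<le> norm x * norm x"
      using y(3) norm_mult_ineq[of y y] mult_mono[of "norm y" "norm x" "norm y" "norm x"] by auto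
    moreover have "norm x * norm x \<le> norm x * 1" using less by (intro mult_left_mono) auto
    ultimately have "norm (x * x + y * y) \<le> 2 * norm x"
      using norm_triangle_ineq[of "x * x" "y * y"] norm_mult_ineq[of x x] by linarith
    then show "?T y \<in> cball 0 (norm x)" by simp
  qed
  have 4: "dist (?T y) (?T z) \<le> norm x * dist y z" if "y \<in> ?S" "z \<in> ?S" for y z
  proof -
    have "?T y - ?T z = (1/2) *\<^sub>R (y * (y - z) + (y - z) * z)"
      by (simp add: algebra_simps)
    then have "norm (?T y - ?T z) = norm (y * (y - z) + (y - z) * z) / 2" by simp
    also have "norm (y * (y - z) + (y - z) * z) \<le> norm y * norm (y - z) + norm (y - z) * norm z"
      by (intro norm_triangle_mono norm_mult_ineq)
    also have "\<dots> \<le> norm x * norm (y - z) + norm (y - z) * norm x"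
      using that by (intro add_mono mult_right_mono mult_left_mono) auto
    finally show ?thesis by (simp add: dist_norm)
  qed
  obtain y where y: "y \<in> ?S" "?T y = y"
    using Banach_fix[OF 1 2 norm_ge_zero less 3] 4 by blast
  have "y + y = 2 *\<^sub>R ?T y" using y(2) by (metis scaleR_2)
  then have "y + y = x * x + y * y" by simp
  with y that show thesis by auto
qed

lemma norm_le_one_of_unitary_partner:
  fixes a c :: "'a::cstar_algebra"
  assumes a: "star a = a" and c: "star c = c" and ac: "a * c = c * a"
    and eq: "c + c = a * a + c * c"
  shows "norm a \<le> 1"
proof -
  have key: "norm (a * a + k *\<^sub>C (a - c * a)) = norm a" if k: "k = \<i> \<or> k = - \<i>" for k
  proof -
    define w where "w = a * a + k *\<^sub>C (a - c * a)"
    have kk: "k * cnj k = 1" "cnj k = - k" "k * k = -1" "cnj k * k = 1" using k by auto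
    have sw: "star w = a * a + cnj k *\<^sub>C (a - a * c)"
      by (simp add: w_def star_add star_mult star_scaleC star_diff a c)
    have caa: "c * (a * z) = a * (c * z)" for z using ac by (metis mult.assoc)
    have "star w * w = a * a * a * a + k *\<^sub>C (a * a * (a - c * a))
        + cnj k *\<^sub>C ((a - a * c) * (a * a)) + (a - a * c) * (a - c * a)"
      by (simp add: sw) (simp add: w_def distrib_left distrib_right mult_scaleC_left
          mult_scaleC_right scaleC_scaleC scaleC_add_right kk scaleC_one mult.assoc)
    also have "(a - a * c) * (a * a) = a * a * (a - c * a)"
      by (simp add: algebra_simps caa ac[symmetric])
    also have "a * a * a * a + k *\<^sub>C (a * a * (a - c * a)) + cnj k *\<^sub>C (a * a * (a - c * a))
        = a * a * a * a + (k + cnj k) *\<^sub>C (a * a * (a - c * a))"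
      by (simp add: scaleC_add_left add.assoc)
    also have "\<dots> = a * a * a * a" using kk by simp
    also have "a * a * a * a + (a - a * c) * (a - c * a)
        = a * (a * a + c * c - (c + c)) * a + a * a"
      by (simp add: algebra_simps)
    also have "\<dots> = star a * a" by (simp add: eq a)
    finally have "(norm w)\<^sup>2 = (norm a)\<^sup>2" by (metis cstar_identity)
    then show ?thesis by (simp add: w_def)
  qed
  define d where "d = a - c * a"
  have "a * a + a * a = (a * a + \<i> *\<^sub>C d) + (a * a + (- \<i>) *\<^sub>C d)"
    using scaleC_add_left[of "\<i>" "- \<i>" d] by (simp add: algebra_simps)
  moreover have "norm (a * a + \<i> *\<^sub>C d) = norm a" "norm (a * a + (- \<i>) *\<^sub>C d) = norm a"
    unfolding d_def by (rule key; simp)+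
  ultimately have "norm (a * a + a * a) \<le> norm a + norm a"
    by (metis norm_triangle_ineq)
  then have "norm (2 *\<^sub>R (a * a)) \<le> 2 * norm a" by (simp add: scaleR_2)
  then have "norm (star a * a) \<le> norm a" by (simp add: a)
  then have "norm a * norm a \<le> 1 * norm a" by (simp add: cstar_identity power2_eq_square)
  then show ?thesis
    by (cases "a = 0") (auto simp: mult_le_cancel_right)
qed

lemma star_hom_norm_le:
  fixes f :: "'a::cstar_algebra \<Rightarrow> 'b::cstar_algebra"
  assumes f: "star_hom f"
  shows "norm (f x) \<le> norm x"
proof -
  have lin: "clinear f" and mult: "\<And>x y. f (x * y) = f x * f y"
    and st: "\<And>x. f (star x) = star (f x)" using f by (auto simp: star_hom_def)
  have one: "norm (f x) \<le> 1" if "star x = x" "norm x < 1" for x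
  proof -
    obtain y where "star y = y" "x * y = y * x" "y + y = x * x + y * y"
      using unitary_partner \<open>star x = x\<close> \<open>norm x < 1\<close> by blast
    then show ?thesis
      using \<open>star x = x\<close>
      by (intro norm_le_one_of_unitary_partner[of "f x" "f y"])
         (metis st mult lin clinear_add)+
  qed
  have sa: "norm (f x) \<le> norm x" if sx: "star x = x" for x
  proof (rule field_le_epsilon)
    fix e :: real assume e: "e > 0"
    define r where "r = norm x + e"
    have r: "r > 0" "norm x < r" using e norm_ge_zero[of x] unfolding r_def by linarith+
    have "norm (f ((1/r) *\<^sub>R x)) \<le> 1"
      using r by (intro one) (auto simp: sx scaleR_scaleC star_scaleC norm_scaleC norm_divide field_simps)
    moreover have "f ((1/r) *\<^sub>R x) = (1/r) *\<^sub>R f x"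
      by (simp only: scaleR_scaleC clinear_scaleC[OF lin])
    ultimately show "norm (f x) \<le> norm x + e" using r by (simp add: r_def field_simps)
  qed
  have "(norm (f x))\<^sup>2 = norm (f (star x * x))" by (simp add: mult st cstar_identity)
  also have "\<dots> \<le> norm (star x * x)" by (rule sa) (simp add: star_mult star_star)
  also have "\<dots> = (norm x)\<^sup>2" by (rule cstar_identity)
  finally show ?thesis using power2_le_imp_le norm_ge_zero by blast
qed

section \<open>Automorphisms and the multiplier algebra\<close>

typedef (overloaded) 'a star_aut = "{f :: 'a::cstar_algebra \<Rightarrow> 'a. bij f \<and> star_hom f}"
  morphisms aut_app Abs_star_aut
  by (rule exI[of _ id]) (simp add: star_hom_def clinear_iff)

setup_lifting type_definition_star_aut

lemma star_hom_bounded_linear: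
  "star_hom f \<Longrightarrow> bounded_linear (f :: 'a::cstar_algebra \<Rightarrow> 'b::cstar_algebra)"
  by (rule bounded_linear_intro[where K = 1])
     (auto simp: star_hom_norm_le star_hom_def clinear_iff scaleR_scaleC)

lemma star_hom_inv:
  assumes "bij f" "star_hom f"
  shows "star_hom (inv_into UNIV f)"
proof -
  have i: "inv_into UNIV f y = x \<longleftrightarrow> y = f x" for x y
    using \<open>bij f\<close> by (metis bij_inv_eq_iff)
  have "f (inv_into UNIV f x) = x" for x using i by metis
  then show ?thesis using assms(2)
    unfolding star_hom_def clinear_iff i by auto
qed

definition bounded_clinear :: "('a::cstar_algebra \<Rightarrow> 'b::cstar_algebra) \<Rightarrow> bool"
  where "bounded_clinear f \<longleftrightarrow> clinear f \<and> bounded_linear f"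

lemma bounded_clinear_compose:
  "bounded_clinear f \<Longrightarrow> bounded_clinear g \<Longrightarrow> bounded_clinear (\<lambda>x. f (g x))"
  by (auto simp: bounded_clinear_def clinear_iff intro: bounded_linear_compose)

text \<open>
  Multipliers are double centralizers \<open>m = (L, R)\<close>, with \<open>L a = m a\<close> and \<open>R a = a m\<close>.
\<close>

definition double_centralizer :: "('a::cstar_algebra \<Rightarrow> 'a) \<Rightarrow> ('a \<Rightarrow> 'a) \<Rightarrow> bool"
  where "double_centralizer L R \<longleftrightarrow> bounded_clinear L \<and> bounded_clinear R \<and>
    (\<forall>a b. L (a * b) = L a * b \<and> R (a * b) = a * R b \<and> R a * b = a * L b)"

typedef (overloaded) 'a multiplier =
  "{(L :: 'a::cstar_algebra \<Rightarrow> 'a, R). double_centralizer L R}"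
  by (rule exI[of _ "(\<lambda>x. x, \<lambda>x. x)"])
     (auto simp: double_centralizer_def bounded_clinear_def clinear_iff)

setup_lifting type_definition_multiplier

lift_definition lmul :: "'a::cstar_algebra multiplier \<Rightarrow> 'a \<Rightarrow> 'a" is fst .
lift_definition rmul :: "'a::cstar_algebra \<Rightarrow> 'a multiplier \<Rightarrow> 'a" is "\<lambda>a m. snd m a" .

instantiation multiplier :: (cstar_algebra) "{complex_star_algebra, monoid_mult}"
begin

lift_definition zero_multiplier :: "'a multiplier" is "(\<lambda>_. 0, \<lambda>_. 0)"
  by (auto simp: double_centralizer_def bounded_clinear_def clinear_iff)

lift_definition one_multiplier :: "'a multiplier" is "(\<lambda>a. a, \<lambda>a. a)"
  by (auto simp: double_centralizer_def bounded_clinear_def clinear_iff)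

lift_definition plus_multiplier :: "'a multiplier \<Rightarrow> 'a multiplier \<Rightarrow> 'a multiplier"
  is "\<lambda>(L, R) (L', R'). (\<lambda>a. L a + L' a, \<lambda>a. R a + R' a)"
  by (auto simp: double_centralizer_def bounded_clinear_def clinear_iff scaleC_add_right
      algebra_simps intro: bounded_linear_add)

lift_definition uminus_multiplier :: "'a multiplier \<Rightarrow> 'a multiplier"
  is "\<lambda>(L, R). (\<lambda>a. - L a, \<lambda>a. - R a)"
  by (auto simp: double_centralizer_def bounded_clinear_def clinear_iff scaleC_minus_right
      algebra_simps intro: bounded_linear_minus)

definition minus_multiplier :: "'a multiplier \<Rightarrow> 'a multiplier \<Rightarrow> 'a multiplier"
  where "minus_multiplier m n = m + - n"

lift_definition times_multiplier :: "'a multiplier \<Rightarrow> 'a multiplier \<Rightarrow> 'a multiplier"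
  is "\<lambda>(L, R) (L', R'). (\<lambda>a. L (L' a), \<lambda>a. R' (R a))"
  by (auto simp: double_centralizer_def bounded_clinear_compose)

lift_definition scaleC_multiplier :: "complex \<Rightarrow> 'a multiplier \<Rightarrow> 'a multiplier"
  is "\<lambda>c (L, R). (\<lambda>a. c *\<^sub>C L a, \<lambda>a. c *\<^sub>C R a)"
  by (auto simp: double_centralizer_def bounded_clinear_def clinear_iff scaleC_add_right
      scaleC_scaleC mult_scaleC_left mult_scaleC_right mult.commute
      intro: bounded_linear_compose[OF bounded_linear_scaleC])

lemma double_centralizer_star:
  fixes L R :: "'a \<Rightarrow> 'a"
  assumes "double_centralizer L R"
  shows "double_centralizer (\<lambda>a. star (R (star a))) (\<lambda>a. star (L (star a)))"
proof -
  have *: "bounded_clinear (\<lambda>a. star (f (star a)))" if "bounded_clinear f" for f :: "'a \<Rightarrow> 'a"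
    using that unfolding bounded_clinear_def clinear_iff
    by (auto simp: star_add star_scaleC
        intro!: bounded_linear_compose[OF bounded_linear_star]
          bounded_linear_compose[OF _ bounded_linear_star])
  have "star (L (star a)) * b = a * star (R (star b))" for a b
    using assms unfolding double_centralizer_def by (metis star_mult star_star)
  then show ?thesis using assms unfolding double_centralizer_def
    by (auto simp: * star_mult star_star)
qed

lift_definition star_multiplier :: "'a multiplier \<Rightarrow> 'a multiplier"
  is "\<lambda>(L, R). (\<lambda>a. star (R (star a)), \<lambda>a. star (L (star a)))"
  by (auto intro: double_centralizer_star)

instance
proof
  fix a b c :: "'a multiplier" and z w :: complex
  show "a + b + c = a + (b + c)" by transfer (auto simp: algebra_simps)
  show "a + b = b + a" by transfer (auto simp: algebra_simps)
  show "0 + a = a" by transfer auto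
  show "- a + a = 0" by transfer auto
  show "a - b = a + - b" by (simp add: minus_multiplier_def)
  show "a * b * c = a * (b * c)" by transfer auto
  show "(a + b) * c = a * c + b * c"
    by transfer (auto simp: double_centralizer_def bounded_clinear_def clinear_iff)
  show "a * (b + c) = a * b + a * c"
    by transfer (auto simp: double_centralizer_def bounded_clinear_def clinear_iff)
  show "1 * a = a" by transfer auto
  show "a * 1 = a" by transfer auto
  show "z *\<^sub>C (a + b) = z *\<^sub>C a + z *\<^sub>C b" by transfer (auto simp: scaleC_add_right)
  show "(z + w) *\<^sub>C a = z *\<^sub>C a + w *\<^sub>C a" by transfer (auto simp: scaleC_add_left)
  show "z *\<^sub>C w *\<^sub>C a = (z * w) *\<^sub>C a" by transfer (auto simp: scaleC_scaleC)
  show "1 *\<^sub>C a = a" by transfer (auto simp: scaleC_one)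
  show "(z *\<^sub>C a) * b = z *\<^sub>C (a * b)"
    by transfer (auto simp: double_centralizer_def bounded_clinear_def clinear_iff)
  show "a * (z *\<^sub>C b) = z *\<^sub>C (a * b)"
    by transfer (auto simp: double_centralizer_def bounded_clinear_def clinear_iff)
  show "star (a + b) = star a + star b" by transfer (auto simp: star_add)
  show "star (z *\<^sub>C a) = cnj z *\<^sub>C star a" by transfer (auto simp: star_scaleC)
  show "star (star a) = a" by transfer (auto simp: star_star)
  show "star (a * b) = star b * star a" by transfer (auto simp: star_star)
qed

end

definition Ad :: "'a::cstar_algebra multiplier \<Rightarrow> 'a \<Rightarrow> 'a"
  where "Ad u a = rmul (lmul u a) (star u)"

text \<open>The unique extension of an automorphism to the multiplier algebra.\<close>

lift_definition aut_multiplier ::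
  "'a::cstar_algebra star_aut \<Rightarrow> 'a multiplier \<Rightarrow> 'a multiplier"
  is "\<lambda>f (L, R). (\<lambda>a. f (L (inv_into UNIV f a)), \<lambda>a. f (R (inv_into UNIV f a)))"
proof (clarsimp)
  fix f L R :: "'a \<Rightarrow> 'a"
  assume f: "bij f" "star_hom f" and LR: "double_centralizer L R"
  have b: "bounded_clinear f" "bounded_clinear (inv_into UNIV f)"
    using f star_hom_inv[OF f] star_hom_bounded_linear
    by (auto simp: bounded_clinear_def star_hom_def)
  have m: "f (x * y) = f x * f y" "inv_into UNIV f (x * y) = inv_into UNIV f x * inv_into UNIV f y"
    "f (inv_into UNIV f x) = x" "inv_into UNIV f (f x) = x" for x y
    using f star_hom_inv[OF f] by (auto simp: star_hom_def bij_is_surj surj_f_inv_f bij_is_inj)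
  have "f (R (inv_into UNIV f a)) * b = a * f (L (inv_into UNIV f b))" for a b
    using LR unfolding double_centralizer_def by (metis m)
  then show "double_centralizer (\<lambda>a. f (L (inv_into UNIV f a))) (\<lambda>a. f (R (inv_into UNIV f a)))"
    using LR b unfolding double_centralizer_def by (auto simp: m intro: bounded_clinear_compose)
qed

section \<open>Anomalous actions and coherent morphisms\<close>

definition anomaly_multiplier ::
  "('g, 'm) monoid_scheme \<Rightarrow> ('g \<Rightarrow> 'a::cstar_algebra star_aut) \<Rightarrow> ('g \<Rightarrow> 'g \<Rightarrow> 'a multiplier) \<Rightarrow>
    'g \<Rightarrow> 'g \<Rightarrow> 'g \<Rightarrow> 'a multiplier"
  where "anomaly_multiplier G \<alpha> u g h k =
    aut_multiplier (\<alpha> g) (u h k) * u g (h \<otimes>\<^bsub>G\<^esub> k) * star (u (g \<otimes>\<^bsub>G\<^esub> h) k) * star (u g h)"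

definition anomalous_action ::
  "('g, 'm) monoid_scheme \<Rightarrow> ('g \<Rightarrow> 'a::cstar_algebra star_aut) \<Rightarrow> ('g \<Rightarrow> 'g \<Rightarrow> 'a multiplier) \<Rightarrow> bool"
  where "anomalous_action G \<alpha> u \<longleftrightarrow>
    (\<forall>g\<in>carrier G. \<forall>h\<in>carrier G. unitary (u g h)) \<and>
    (\<forall>g\<in>carrier G. \<forall>h\<in>carrier G. \<forall>a.
       aut_app (\<alpha> g) (aut_app (\<alpha> h) a) = Ad (u g h) (aut_app (\<alpha> (g \<otimes>\<^bsub>G\<^esub> h)) a)) \<and>
    (\<forall>g\<in>carrier G. \<forall>h\<in>carrier G. \<forall>k\<in>carrier G.
       \<exists>z. cmod z = 1 \<and> anomaly_multiplier G \<alpha> u g h k = z *\<^sub>C 1) \<and>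
    (\<forall>g\<in>carrier G. u g \<one>\<^bsub>G\<^esub> = 1 \<and> u \<one>\<^bsub>G\<^esub> g = 1)"

text \<open>
  A relation and not a function because the scalars are determined only if the algebra is
  nonzero. For a nonzero algebra \<open>\<omega>\<close> is unique on \<open>carrier G\<close> and is automatically a normalised
  3-cocycle.
\<close>

definition has_anomaly ::
  "('g, 'm) monoid_scheme \<Rightarrow> ('g \<Rightarrow> 'a::cstar_algebra star_aut) \<Rightarrow> ('g \<Rightarrow> 'g \<Rightarrow> 'a multiplier) \<Rightarrow>
    ('g \<Rightarrow> 'g \<Rightarrow> 'g \<Rightarrow> complex) \<Rightarrow> bool"
  where "has_anomaly G \<alpha> u \<omega> \<longleftrightarrow>
    (\<forall>g\<in>carrier G. \<forall>h\<in>carrier G. \<forall>k\<in>carrier G.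
       cmod (\<omega> g h k) = 1 \<and> anomaly_multiplier G \<alpha> u g h k = \<omega> g h k *\<^sub>C 1)"

definition coherent_morphism ::
  "('g, 'm) monoid_scheme \<Rightarrow>
    ('g \<Rightarrow> 'a::cstar_algebra star_aut) \<Rightarrow> ('g \<Rightarrow> 'g \<Rightarrow> 'a multiplier) \<Rightarrow>
    ('g \<Rightarrow> 'b::cstar_algebra star_aut) \<Rightarrow> ('g \<Rightarrow> 'g \<Rightarrow> 'b multiplier) \<Rightarrow>
    ('g \<Rightarrow> 'a \<Rightarrow> 'b) \<Rightarrow> bool"
  where "coherent_morphism G \<alpha> u \<beta> v \<phi> \<longleftrightarrow>
    (\<forall>g\<in>carrier G. clinear (\<phi> g)) \<and>
    (\<forall>g\<in>carrier G. \<forall>a b. star (\<phi> g a) * \<phi> g b = \<phi> \<one>\<^bsub>G\<^esub> (star a * b)) \<and>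
    (\<forall>g\<in>carrier G. \<forall>h\<in>carrier G. \<forall>a b.
       \<phi> (g \<otimes>\<^bsub>G\<^esub> h) (lmul (star (u g h)) (aut_app (\<alpha> g) a * b)) =
       lmul (star (v g h)) (aut_app (\<beta> g) (\<phi> h a) * \<phi> g b))"

definition approx_MvN :: "('a::cstar_algebra \<Rightarrow> 'b::cstar_algebra) \<Rightarrow> ('a \<Rightarrow> 'b) \<Rightarrow> bool"
  where "approx_MvN \<phi> \<psi> \<longleftrightarrow>
    (\<forall>\<epsilon>>0. \<forall>F. finite F \<longrightarrow>
      (\<exists>v. \<forall>a\<in>F. norm (star v * \<phi> a * v - \<psi> a) < \<epsilon> \<and> norm (v * \<psi> a * star v - \<phi> a) < \<epsilon>))"

definition approx_MvN_coherent ::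
  "('g, 'm) monoid_scheme \<Rightarrow> ('g \<Rightarrow> 'b::cstar_algebra star_aut) \<Rightarrow>
    ('g \<Rightarrow> 'a::cstar_algebra \<Rightarrow> 'b) \<Rightarrow> ('g \<Rightarrow> 'a \<Rightarrow> 'b) \<Rightarrow> bool"
  where "approx_MvN_coherent G \<beta> \<phi> \<psi> \<longleftrightarrow>
    (\<forall>\<epsilon>>0. \<forall>K F. finite K \<and> K \<subseteq> carrier G \<and> finite F \<longrightarrow>
      (\<exists>v. \<forall>g\<in>K. \<forall>a\<in>F.
         norm (aut_app (\<beta> g) (star v) * \<phi> g a * v - \<psi> g a) < \<epsilon> \<and>
         norm (aut_app (\<beta> g) v * \<psi> g a * star v - \<phi> g a) < \<epsilon>))"

section \<open>Central sequences and the Rokhlin property\<close>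

subsection \<open>The sequence algebra\<close>

text \<open>
  \<open>'b seq_alg\<close> is the algebra of bounded sequences modulo null sequences: the relation is partial,
  with domain the bounded sequences.
\<close>

definition seq_rel :: "(nat \<Rightarrow> 'b::cstar_algebra) \<Rightarrow> (nat \<Rightarrow> 'b) \<Rightarrow> bool"
  where "seq_rel x y \<longleftrightarrow> Bseq x \<and> Bseq y \<and> (\<lambda>n. x n - y n) \<longlonglongrightarrow> 0"

lemma part_equivp_seq_rel: "part_equivp (seq_rel :: (nat \<Rightarrow> 'b::cstar_algebra) \<Rightarrow> _)"
proof (rule part_equivpI)
  show "\<exists>x. seq_rel x (x :: nat \<Rightarrow> 'b)"
    by (rule exI[of _ "\<lambda>_. 0"]) (auto simp: seq_rel_def Bseq_def intro: exI[of _ 1])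
  show "symp (seq_rel :: (nat \<Rightarrow> 'b) \<Rightarrow> _)"
  proof (rule sympI)
    fix x y :: "nat \<Rightarrow> 'b" assume "seq_rel x y"
    then show "seq_rel y x" unfolding seq_rel_def using tendsto_minus by fastforce
  qed
  show "transp (seq_rel :: (nat \<Rightarrow> 'b) \<Rightarrow> _)"
  proof (rule transpI)
    fix x y z :: "nat \<Rightarrow> 'b" assume "seq_rel x y" "seq_rel y z"
    then show "seq_rel x z" unfolding seq_rel_def
      using tendsto_add[of "\<lambda>n. x n - y n" 0 sequentially "\<lambda>n. y n - z n" 0] by simp
  qed
qed

quotient_type (overloaded) 'b seq_alg = "nat \<Rightarrow> 'b::cstar_algebra" / partial: seq_rel
  by (rule part_equivp_seq_rel)

lemma Bseq_plus: "Bseq f \<Longrightarrow> Bseq g \<Longrightarrow> Bseq (\<lambda>n. f n + g n :: 'b::cstar_algebra)"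
  unfolding Bseq_eq_bounded by (auto intro!: bounded_plus_comp)

lemma Bseq_times: "Bseq f \<Longrightarrow> Bseq g \<Longrightarrow> Bseq (\<lambda>n. f n * g n :: 'b::cstar_algebra)"
proof -
  assume "Bseq f" "Bseq g"
  then obtain K L where "\<And>n. norm (f n) \<le> K" "\<And>n. norm (g n) \<le> L"
    unfolding Bseq_def by blast
  then have "norm (f n * g n) \<le> K * L" for n
    by (meson norm_mult_ineq mult_mono norm_ge_zero order_trans)
  then show ?thesis by (rule BseqI')
qed

lemma Bseq_linear:
  assumes "bounded_linear f" "Bseq x"
  shows "Bseq (\<lambda>n. f (x n) :: 'b::cstar_algebra)"
  using assms unfolding Bseq_eq_bounded
  using bounded_linear_image[of "range x" f] by (simp add: image_image)

lemma seq_rel_linear: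
  assumes f: "bounded_linear f" and "seq_rel x y"
  shows "seq_rel (\<lambda>n. f (x n)) (\<lambda>n. f (y n))"
proof -
  have "(\<lambda>n. f (x n - y n)) \<longlonglongrightarrow> 0"
    using assms(2) bounded_linear.tendsto_zero[OF f] by (auto simp: seq_rel_def)
  then show ?thesis using assms
    by (auto simp: seq_rel_def linear_diff bounded_linear.linear Bseq_linear)
qed

lemma seq_rel_refl: "seq_rel x x \<longleftrightarrow> Bseq x"
  by (auto simp: seq_rel_def)

instantiation seq_alg :: (cstar_algebra) complex_star_algebra
begin

lift_definition zero_seq_alg :: "'a seq_alg" is "\<lambda>_. 0"
  by (auto simp: seq_rel_def Bseq_def intro: exI[of _ 1])

lift_definition plus_seq_alg :: "'a seq_alg \<Rightarrow> 'a seq_alg \<Rightarrow> 'a seq_alg"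
  is "\<lambda>x y n. x n + y n"
proof -
  fix x x' y y' :: "nat \<Rightarrow> 'a"
  assume "seq_rel x x'" "seq_rel y y'"
  then show "seq_rel (\<lambda>n. x n + y n) (\<lambda>n. x' n + y' n)" unfolding seq_rel_def
    using tendsto_add[of "\<lambda>n. x n - x' n" 0 sequentially "\<lambda>n. y n - y' n" 0]
    by (auto simp: Bseq_plus algebra_simps)
qed

lift_definition uminus_seq_alg :: "'a seq_alg \<Rightarrow> 'a seq_alg" is "\<lambda>x n. - x n"
  by (rule seq_rel_linear) (auto intro: bounded_linear_minus)

definition minus_seq_alg :: "'a seq_alg \<Rightarrow> 'a seq_alg \<Rightarrow> 'a seq_alg"
  where "minus_seq_alg x y = x + - y"

lift_definition times_seq_alg :: "'a seq_alg \<Rightarrow> 'a seq_alg \<Rightarrow> 'a seq_alg"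
  is "\<lambda>x y n. x n * y n"
proof -
  fix x x' y y' :: "nat \<Rightarrow> 'a"
  assume a: "seq_rel x x'" "seq_rel y y'"
  have "(\<lambda>n. (x n - x' n) * y n) \<longlonglongrightarrow> 0" "(\<lambda>n. x' n * (y n - y' n)) \<longlonglongrightarrow> 0"
    using a unfolding seq_rel_def tendsto_Zfun_iff
    by (auto intro: bounded_bilinear.Zfun_prod_Bfun[OF bounded_bilinear_mult]
        bounded_bilinear.Bfun_prod_Zfun[OF bounded_bilinear_mult])
  from tendsto_add[OF this] show "seq_rel (\<lambda>n. x n * y n) (\<lambda>n. x' n * y' n)"
    using a unfolding seq_rel_def by (auto simp: Bseq_times algebra_simps)
qed

lift_definition scaleC_seq_alg :: "complex \<Rightarrow> 'a seq_alg \<Rightarrow> 'a seq_alg"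
  is "\<lambda>c x n. c *\<^sub>C x n"
  by (rule seq_rel_linear) (rule bounded_linear_scaleC)

lift_definition star_seq_alg :: "'a seq_alg \<Rightarrow> 'a seq_alg" is "\<lambda>x n. star (x n)"
  by (rule seq_rel_linear) (rule bounded_linear_star)

instance
proof
  fix a b c :: "'a seq_alg" and z w :: complex
  note l = Bseq_plus Bseq_times Bseq_linear[OF bounded_linear_star]
    Bseq_linear[OF bounded_linear_scaleC] seq_rel_refl
  show "a + b + c = a + (b + c)" by transfer (auto simp: algebra_simps l)
  show "a + b = b + a" by transfer (auto simp: algebra_simps l)
  show "0 + a = a" by transfer auto
  show "- a + a = 0" by transfer (auto simp: seq_rel_def Bseq_def intro: exI[of _ 1])
  show "a - b = a + - b" by (simp add: minus_seq_alg_def)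
  show "a * b * c = a * (b * c)" by transfer (auto simp: algebra_simps l)
  show "(a + b) * c = a * c + b * c" by transfer (auto simp: algebra_simps l)
  show "a * (b + c) = a * b + a * c" by transfer (auto simp: algebra_simps l)
  show "z *\<^sub>C (a + b) = z *\<^sub>C a + z *\<^sub>C b" by transfer (auto simp: scaleC_add_right l)
  show "(z + w) *\<^sub>C a = z *\<^sub>C a + w *\<^sub>C a" by transfer (auto simp: scaleC_add_left l)
  show "z *\<^sub>C w *\<^sub>C a = (z * w) *\<^sub>C a" by transfer (auto simp: scaleC_scaleC l)
  show "1 *\<^sub>C a = a" by transfer (auto simp: scaleC_one)
  show "(z *\<^sub>C a) * b = z *\<^sub>C (a * b)" by transfer (auto simp: mult_scaleC_left l)
  show "a * (z *\<^sub>C b) = z *\<^sub>C (a * b)" by transfer (auto simp: mult_scaleC_right l)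
  show "star (a + b) = star a + star b" by transfer (auto simp: star_add l)
  show "star (z *\<^sub>C a) = cnj z *\<^sub>C star a" by transfer (auto simp: star_scaleC l)
  show "star (star a) = a" by transfer (auto simp: star_star)
  show "star (a * b) = star b * star a" by transfer (auto simp: star_mult l)
qed

end

lift_definition const_seq :: "'b::cstar_algebra \<Rightarrow> 'b seq_alg" is "\<lambda>b n. b"
  by (auto simp: seq_rel_refl Bseq_def intro!: exI[of _ "norm _ + 1"] add_nonneg_pos)

lemma star_const_seq: "star (const_seq b) = const_seq (star b)"
  by transfer (auto simp: seq_rel_refl Bseq_def intro!: exI[of _ "norm _ + 1"] add_nonneg_pos)

lift_definition aut_seq :: "'b::cstar_algebra star_aut \<Rightarrow> 'b seq_alg \<Rightarrow> 'b seq_alg"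
  is "\<lambda>f x n. f (x n)"
  by (rule seq_rel_linear) (auto intro: star_hom_bounded_linear)

lemma aut_seq_const_seq: "aut_seq f (const_seq b) = const_seq (aut_app f b)"
  by transfer (auto simp: seq_rel_refl Bseq_def intro!: exI[of _ "norm _ + 1"] add_nonneg_pos)

lemma star_hom_aut_seq: "star_hom (aut_seq f)"
  unfolding star_hom_def clinear_iff
proof safe
  fix x y :: "'a seq_alg" and c :: complex
  have I: "seq_rel (\<lambda>n. h (x n)) y"
    if "bij h \<and> star_hom h" "Bseq x" "\<And>n. h (x n) = y n" for h :: "'a \<Rightarrow> 'a" and x y
    using that Bseq_linear[OF star_hom_bounded_linear, of h x] by (simp add: seq_rel_refl)
  note l = Bseq_plus Bseq_times Bseq_linear[OF bounded_linear_star]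
    Bseq_linear[OF bounded_linear_scaleC] seq_rel_refl
  show "aut_seq f (x + y) = aut_seq f x + aut_seq f y"
    by transfer (rule I, simp_all add: l, simp add: star_hom_def clinear_iff)
  show "aut_seq f (c *\<^sub>C x) = c *\<^sub>C aut_seq f x"
    by transfer (rule I, simp_all add: l, simp add: star_hom_def clinear_iff)
  show "aut_seq f (x * y) = aut_seq f x * aut_seq f y"
    by transfer (rule I, simp_all add: l, simp add: star_hom_def clinear_iff)
  show "aut_seq f (star x) = star (aut_seq f x)"
    by transfer (rule I, simp_all add: l, simp add: star_hom_def clinear_iff)
qed

subsection \<open>The central sequence algebra\<close>

text \<open>
  \<open>'b central_seq_alg\<close> is the quotient of the relative commutant of \<open>'b\<close> in \<open>'b seq_alg\<close> by the
  annihilator, where \<open>'b\<close> is embedded by \<open>const_seq\<close>.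
\<close>

definition rel_commutant :: "'b::cstar_algebra seq_alg set"
  where "rel_commutant = {x. \<forall>b. x * const_seq b = const_seq b * x}"

definition rel_annihilator :: "'b::cstar_algebra seq_alg set"
  where "rel_annihilator = {x. \<forall>b. x * const_seq b = 0 \<and> const_seq b * x = 0}"

definition central_rel :: "'b::cstar_algebra seq_alg \<Rightarrow> 'b seq_alg \<Rightarrow> bool"
  where "central_rel x y \<longleftrightarrow> x \<in> rel_commutant \<and> y \<in> rel_commutant \<and> x - y \<in> rel_annihilator"

lemma central_rel_iff:
  "central_rel x y \<longleftrightarrow> x \<in> rel_commutant \<and> y \<in> rel_commutant \<and>
    (\<forall>b. x * const_seq b = y * const_seq b)"
  by (auto simp: central_rel_def rel_commutant_def rel_annihilator_def left_diff_distrib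
      right_diff_distrib)

lemma rel_commutant_closed:
  assumes "x \<in> rel_commutant" "y \<in> rel_commutant"
  shows "x + y \<in> rel_commutant" "- x \<in> rel_commutant" "c *\<^sub>C x \<in> rel_commutant"
    "x * y \<in> rel_commutant" "star x \<in> rel_commutant"
proof -
  have x: "x * const_seq b = const_seq b * x" and y: "y * const_seq b = const_seq b * y" for b
    using assms by (auto simp: rel_commutant_def)
  show "x + y \<in> rel_commutant" "- x \<in> rel_commutant" "c *\<^sub>C x \<in> rel_commutant"
    by (auto simp: rel_commutant_def distrib_left distrib_right x y mult_scaleC_left
        mult_scaleC_right)
  have "x * y * const_seq b = const_seq b * (x * y)" for b
    by (metis x y mult.assoc)
  then show "x * y \<in> rel_commutant" by (simp add: rel_commutant_def)
  have "star x * const_seq b = const_seq b * star x" for b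
    by (metis x star_mult star_star star_const_seq)
  then show "star x \<in> rel_commutant" by (simp add: rel_commutant_def)
qed

lemma zero_rel_commutant: "0 \<in> rel_commutant"
  by (auto simp: rel_commutant_def)

quotient_type (overloaded) 'b central_seq_alg = "'b::cstar_algebra seq_alg" / partial: central_rel
  by (rule part_equivpI)
     (auto simp: central_rel_iff symp_def transp_def intro: exI[of _ 0] zero_rel_commutant)

instantiation central_seq_alg :: (cstar_algebra) complex_star_algebra
begin

lift_definition zero_central_seq_alg :: "'a central_seq_alg" is 0
  by (auto simp: central_rel_iff zero_rel_commutant)

lift_definition plus_central_seq_alg ::
  "'a central_seq_alg \<Rightarrow> 'a central_seq_alg \<Rightarrow> 'a central_seq_alg" is "(+)"
  by (auto simp: central_rel_iff rel_commutant_closed distrib_right)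

lift_definition uminus_central_seq_alg :: "'a central_seq_alg \<Rightarrow> 'a central_seq_alg" is uminus
  by (auto simp: central_rel_iff rel_commutant_closed)

definition minus_central_seq_alg ::
  "'a central_seq_alg \<Rightarrow> 'a central_seq_alg \<Rightarrow> 'a central_seq_alg"
  where "minus_central_seq_alg x y = x + - y"

lift_definition times_central_seq_alg ::
  "'a central_seq_alg \<Rightarrow> 'a central_seq_alg \<Rightarrow> 'a central_seq_alg" is "(*)"
proof -
  fix x x' y y' :: "'a seq_alg"
  assume a: "central_rel x x'" "central_rel y y'"
  have x: "x * const_seq b = x' * const_seq b" and y: "y * const_seq b = y' * const_seq b"
    and y': "y' * const_seq b = const_seq b * y'" for b
    using a by (auto simp: central_rel_iff rel_commutant_def)
  have "x * y * const_seq b = x' * y' * const_seq b" for b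
  proof -
    have "x * y * const_seq b = x * const_seq b * y'" by (simp only: mult.assoc y y')
    also have "\<dots> = x' * y' * const_seq b" by (simp only: x mult.assoc y')
    finally show ?thesis .
  qed
  then show "central_rel (x * y) (x' * y')"
    using a by (auto simp: central_rel_iff rel_commutant_closed)
qed

lift_definition scaleC_central_seq_alg :: "complex \<Rightarrow> 'a central_seq_alg \<Rightarrow> 'a central_seq_alg"
  is scaleC
  by (auto simp: central_rel_iff rel_commutant_closed mult_scaleC_left)

lift_definition star_central_seq_alg :: "'a central_seq_alg \<Rightarrow> 'a central_seq_alg" is star
proof -
  fix x y :: "'a seq_alg" assume a: "central_rel x y"
  have xy: "const_seq b * x = const_seq b * y" for b
    using a unfolding central_rel_iff rel_commutant_def by (metis (mono_tags, lifting) mem_Collect_eq)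
  have "star x * const_seq b = star y * const_seq b" for b
  proof -
    have "star x * const_seq b = star (const_seq (star b) * x)"
      by (simp add: star_mult star_const_seq star_star)
    also have "\<dots> = star y * const_seq b"
      by (simp add: xy star_mult star_const_seq star_star)
    finally show ?thesis .
  qed
  then show "central_rel (star x) (star y)"
    using a by (auto simp: central_rel_iff rel_commutant_closed)
qed

instance
proof
  fix a b c :: "'a central_seq_alg" and z w :: complex
  note l = central_rel_iff rel_commutant_closed
  show "a + b + c = a + (b + c)" by transfer (auto simp: algebra_simps l)
  show "a + b = b + a" by transfer (auto simp: algebra_simps l)
  show "0 + a = a" by transfer auto
  show "- a + a = 0" by transfer (auto simp: l zero_rel_commutant)
  show "a - b = a + - b" by (simp add: minus_central_seq_alg_def)
  show "a * b * c = a * (b * c)" by transfer (auto simp: mult.assoc l)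
  show "(a + b) * c = a * c + b * c" by transfer (auto simp: distrib_right l)
  show "a * (b + c) = a * b + a * c" by transfer (auto simp: distrib_left l)
  show "z *\<^sub>C (a + b) = z *\<^sub>C a + z *\<^sub>C b" by transfer (auto simp: scaleC_add_right l)
  show "(z + w) *\<^sub>C a = z *\<^sub>C a + w *\<^sub>C a" by transfer (auto simp: scaleC_add_left l)
  show "z *\<^sub>C w *\<^sub>C a = (z * w) *\<^sub>C a" by transfer (auto simp: scaleC_scaleC l)
  show "1 *\<^sub>C a = a" by transfer (auto simp: scaleC_one)
  show "(z *\<^sub>C a) * b = z *\<^sub>C (a * b)" by transfer (auto simp: mult_scaleC_left l)
  show "a * (z *\<^sub>C b) = z *\<^sub>C (a * b)" by transfer (auto simp: mult_scaleC_right l)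
  show "star (a + b) = star a + star b" by transfer (auto simp: star_add l)
  show "star (z *\<^sub>C a) = cnj z *\<^sub>C star a" by transfer (auto simp: star_scaleC l)
  show "star (star a) = a" by transfer (auto simp: star_star)
  show "star (a * b) = star b * star a" by transfer (auto simp: star_mult l)
qed

end

lift_definition aut_central ::
  "'b::cstar_algebra star_aut \<Rightarrow> 'b central_seq_alg \<Rightarrow> 'b central_seq_alg" is aut_seq
proof -
  fix f :: "'b star_aut" and x y :: "'b seq_alg"
  assume a: "central_rel x y"
  have surj: "\<exists>b'. const_seq b = aut_seq f (const_seq b')" for b
    using aut_app[of f] by (metis (no_types, lifting) aut_seq_const_seq bij_pointE mem_Collect_eq)
  have m: "aut_seq f (x * y) = aut_seq f x * aut_seq f y" for x y
    using star_hom_aut_seq by (auto simp: star_hom_def)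
  have c: "aut_seq f z \<in> rel_commutant" if "z \<in> rel_commutant" for z
    using that unfolding rel_commutant_def by (auto, metis m surj)
  have "aut_seq f x * const_seq b = aut_seq f y * const_seq b" for b
    using a unfolding central_rel_iff by (metis m surj)
  then show "central_rel (aut_seq f x) (aut_seq f y)"
    using a c by (auto simp: central_rel_iff)
qed

definition rokhlin_property ::
  "('g, 'm) monoid_scheme \<Rightarrow> ('g \<Rightarrow> 'b::cstar_algebra star_aut) \<Rightarrow> bool"
  where "rokhlin_property G \<beta> \<longleftrightarrow>
    (\<exists>p. projection p \<and> is_unit_element (\<Sum>g\<in>carrier G. aut_central (\<beta> g) p))"

end

theory Submission
  imports Defs
begin

text \<open>
  A coherent morphism behaves as if \<open>\<phi> g a = s g * \<phi> \<one> a\<close> for unitary operators \<open>s g\<close> that are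
  subject to two rules: \<open>s g\<close> intertwines \<open>\<phi> \<one>\<close> with \<open>\<beta> g \<circ> \<phi> \<one> \<circ> (\<alpha> g)\<inverse>\<close>, and
  \<open>\<beta> g (s h) * s g = v g h * s (g h) * \<phi> \<one> (u g h)\<^sup>*\<close>. Let \<open>t g\<close> be the operators belonging to \<open>\<psi>\<close>, and let
  \<open>x\<close> implement the equivalence of \<open>\<phi> \<one>\<close> and \<open>\<psi> \<one>\<close> approximately. The elements
  \<open>w h = (s h)\<^sup>* * \<beta> h x * t h\<close> then satisfy
  \<open>\<beta> g (w h)\<^sup>* * \<phi> g a * w (g h) \<approx> \<psi> g a\<close>, because both cocycles \<open>u\<close> and \<open>v\<close> cancel. This
  is the required relation, except that the index moves from \<open>h\<close> to \<open>g h\<close>. The Rokhlin projections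
  \<open>P h\<close> are central, pairwise orthogonal, sum to one, and are moved by \<open>\<beta> g\<close> in just this way. Hence
  all cross terms vanish for \<open>W = (\<Sum>h. P h * w h)\<close>, and an element far out in a sequence that represents
  \<open>W\<close> implements the coherent equivalence.

  The operators \<open>s h\<close> are not elements of the algebra. They are replaced by \<open>\<phi> h e\<close> with \<open>e\<close> from an
  approximate unit of the domain; with this choice the computation is exact up to two errors, one
  from \<open>x\<close> and one from \<open>e\<close> (lemma \<open>norm_transport_le\<close>). The error from \<open>x\<close> involves
  \<open>x\<close> only through compressions such as \<open>x\<^sup>* * \<phi> \<one> c * x\<close>, so it is small when \<open>x\<close> is chosen after
  \<open>e\<close>, however large the norm of \<open>x\<close> may be.

  Two facts about C*-algebras carry the rest. Bounded approximate units are obtained from the Cayley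
  transform: \<open>1 - (1 + k)\<inverse>\<close> with \<open>k\<close> skew-adjoint and large is almost a unit for \<open>k\<close>
  (lemma \<open>approximate_unit\<close>). Projections that sum to one are orthogonal, because the identity
  operator is an average of linear contractions only in the trivial way
  (lemmas \<open>average_of_contractions_is_identity\<close> and \<open>central_projections_orthogonal\<close>). Both arguments
  use the norm only and no order structure.
\<close>

section \<open>Bounded approximate units in C*-algebras\<close>

text \<open>
  The hypotheses say that \<open>1 - c\<close> is the inverse of \<open>1 + k\<close> in the unitization. As \<open>k\<close> is
  skew-adjoint, the Cayley transform \<open>(1 - k) (1 + k)\<inverse> = 1 - 2 c\<close> is unitary, and the conclusion is
  one half of this statement, written without a unit.
\<close>

lemma resolvent_identity:
  fixes c k :: "'a::complex_star_algebra"
  assumes "star k = - k" and "k = c + k * c" and "k = c + c * k"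
  shows "c + star c = star c * c + star c * c"
proof -
  have kc: "k * c = k - c" using assms(2) by (simp add: algebra_simps)
  have "c * k = k - c" using assms(3) by (simp add: algebra_simps)
  then have "star (k - c) = star k * star c \<and> star (k - c) = star c * star k"
    by (metis kc star_mult)
  then have ck: "star c * k = star c + k"
    using assms(1) by (simp add: star_diff) (metis add.commute diff_minus_eq_add minus_diff_eq neg_equal_iff_equal)
  have "star c * (k * c) = star c + k - star c * c" by (simp add: kc right_diff_distrib ck)
  moreover have "star c * (k * c) = star c * c + (k - c)"
    by (metis ck distrib_right kc mult.assoc)
  ultimately show ?thesis by (simp add: algebra_simps)
qed

text \<open>
  Left multiplication by \<open>1 - e\<close> is a contraction. This property survives products of the elements
  \<open>1 - e\<close>, which keeps approximate units for larger and larger finite sets bounded.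
\<close>

definition contractive_complement :: "'a::cstar_algebra \<Rightarrow> bool"
  where "contractive_complement e \<longleftrightarrow> (\<forall>x. norm (x - e * x) \<le> norm x)"

lemma norm_eqI_star_mult:
  fixes x y :: "'a::cstar_algebra"
  assumes "star x * x = star y * y"
  shows "norm x = norm y"
  using assms by (metis cstar_identity norm_ge_zero power2_eq_iff_nonneg)

text \<open>
  The element \<open>1 - 2 c\<close> is isometric, and \<open>1 - c\<close> is the average of \<open>1\<close> and \<open>1 - 2 c\<close>.
\<close>

lemma resolvent_bounds:
  fixes c :: "'a::cstar_algebra"
  assumes "c + star c = star c * c + star c * c"
  shows "norm c \<le> 1" and "contractive_complement c"
proof -
  have "2 * (norm c)\<^sup>2 = norm (2 *\<^sub>R (star c * c))" by (simp add: cstar_identity)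
  also have "\<dots> = norm (c + star c)" by (simp add: assms scaleR_2)
  also have "\<dots> \<le> 2 * norm c" using norm_triangle_ineq[of c "star c"] by (simp add: norm_star)
  finally have "norm c * norm c \<le> 1 * norm c" by (simp add: power2_eq_square)
  then show "norm c \<le> 1" by (cases "c = 0") (auto simp: mult_le_cancel_right)
  show "contractive_complement c" unfolding contractive_complement_def
  proof
    fix x
    define r where "r = x - (c + c) * x"
    have "star r * r = star x * x - star x * ((c + star c) + (c + star c)
        - (star c * c + star c * c) - (star c * c + star c * c)) * x"
      by (simp add: r_def star_diff star_mult star_add algebra_simps)
    also have "\<dots> = star x * x" by (simp add: assms)
    finally have "norm r = norm x" by (rule norm_eqI_star_mult)
    moreover have "2 *\<^sub>R (x - c * x) = x + r" by (simp add: r_def scaleR_2 algebra_simps)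
    ultimately have "norm (2 *\<^sub>R (x - c * x)) \<le> 2 * norm x"
      using norm_triangle_ineq[of x r] by simp
    then show "norm (x - c * x) \<le> norm x" by simp
  qed
qed

text \<open>
  Invertibility of \<open>1 + t k\<close> for all real \<open>t\<close>, by the method of continuity: the inverse at \<open>t = n\<close>
  is a contraction, whatever \<open>n\<close> is, so the Neumann series for the inverse at \<open>t = n + 1\<close>
  converges. The step is written as a fixed point equation.
\<close>

lemma resolvent_multiple:
  fixes k :: "'a::cstar_algebra"
  assumes k: "star k = - k" and less: "norm k < 1"
  shows "\<exists>c. real n *\<^sub>R k = c + (real n *\<^sub>R k) * c \<and> real n *\<^sub>R k = c + c * (real n *\<^sub>R k)"
proof (induction n)
  case (Suc n)
  define K where "K = real n *\<^sub>R k"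
  obtain c where c: "K = c + K * c" "K = c + c * K" using Suc K_def by blast
  have K: "star K = - K" by (simp add: K_def scaleR_scaleC star_scaleC k scaleC_minus_right)
  have ck: "c * k = k * c"
  proof (cases "n = 0")
    case True
    then show ?thesis using c by (simp add: K_def)
  next
    case False
    have "c * K = K * c" using c by (metis add_left_cancel)
    then show ?thesis using False by (simp add: K_def)
  qed
  define d where "d = k - c * k"
  have nd: "norm d \<le> norm k" unfolding d_def
    using resolvent_bounds(2)[OF resolvent_identity[OF K c]]
    by (simp add: contractive_complement_def)
  \<comment> \<open>\<open>(1 + K)\<inverse> (1 + K + k) = 1 + d\<close>, and \<open>?f c' = c'\<close> says \<open>(1 + d) (1 - c') = 1 - c\<close>\<close>
  let ?S = "{y. k * y = y * k}"
  let ?f = "\<lambda>y. c + d - d * y"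
  have "closed ?S" by (intro closed_Collect_eq continuous_intros)
  then have 1: "complete ?S" by (simp add: complete_eq_closed)
  have "0 \<in> ?S" by simp
  then have 2: "?S \<noteq> {}" by blast
  have kd: "k * d = d * k"
  proof -
    have "k * (c * k) = c * k * k" by (simp only: mult.assoc[symmetric]) (simp only: ck)
    then show ?thesis by (simp add: d_def left_diff_distrib right_diff_distrib)
  qed
  have 3: "?f ` ?S \<subseteq> ?S"
  proof safe
    fix y assume y: "k * y = y * k"
    have "k * (d * y) = d * y * k" by (metis kd y mult.assoc)
    then show "k * ?f y = ?f y * k" by (simp add: distrib_left distrib_right
          left_diff_distrib right_diff_distrib ck kd)
  qed
  have 4: "dist (?f y) (?f z) \<le> norm k * dist y z" for y z
  proof -
    have "?f y - ?f z = - (d * (y - z))" by (simp add: algebra_simps)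
    then have "norm (?f y - ?f z) \<le> norm d * norm (y - z)"
      by (metis norm_minus_cancel norm_mult_ineq)
    also have "\<dots> \<le> norm k * norm (y - z)" using nd by (simp add: mult_right_mono)
    finally show ?thesis by (simp add: dist_norm)
  qed
  obtain c' where c': "c' \<in> ?S" "?f c' = c'"
    using Banach_fix[OF 1 2 norm_ge_zero less 3] 4 by blast
  \<comment> \<open>\<open>(1 + K) d = k\<close>, as \<open>d = (1 - c) k\<close>\<close>
  have Kd: "d + K * d = k"
  proof -
    have "d + K * d = k + (K - (c + K * c)) * k" by (simp add: d_def algebra_simps)
    then show ?thesis by (simp only: c(1)[symmetric]) simp
  qed
  have "c' - c - d + d * c' = 0" using c'(2) by (simp add: algebra_simps)
  then have "(c' - c - d + d * c') + K * (c' - c - d + d * c') = 0" by simp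
  then have "c' + K * c' - (c + K * c) - (d + K * d) + (d + K * d) * c' = 0"
    by (simp add: algebra_simps)
  then have "c' + K * c' - K - k + k * c' = 0" by (simp only: Kd c(1)[symmetric])
  then have "(c' + K * c' - K - k + k * c') + (K + k) = K + k" by (simp only: add_0)
  then have left: "K + k = c' + (K + k) * c'"
    by (simp add: distrib_right add.assoc)
  have "K * c' = c' * K" using c'(1) unfolding K_def by simp
  then have comm: "(K + k) * c' = c' * (K + k)"
    using c'(1) by (simp add: distrib_left distrib_right)
  have right: "K + k = c' + c' * (K + k)" using left unfolding comm .
  have sum: "real (Suc n) *\<^sub>R k = K + k" by (simp add: K_def scaleR_left_distrib)
  show ?case unfolding sum using left right by blast
qed simp

text \<open>
  Let \<open>1 - c\<close> be the inverse of \<open>1 + k\<close> for \<open>k = \<i> x / \<delta>\<close>. Then \<open>c = (1 - c) k\<close>, and \<open>norm c \<le> 1\<close>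
  bounds \<open>(1 - c) x\<close> by \<open>\<delta>\<close>.
\<close>

lemma selfadjoint_approximate_unit:
  fixes x :: "'a::cstar_algebra"
  assumes x: "star x = x" and \<delta>: "\<delta> > 0"
  obtains c where "contractive_complement c" "norm c \<le> 1" "norm (x - c * x) \<le> \<delta>"
proof -
  obtain n where n: "real n > norm x / \<delta>" using reals_Archimedean2 by blast
  then have n0: "real n > 0" using \<delta> by (smt (verit) divide_nonneg_pos norm_ge_zero)
  define k where "k = (\<i> * complex_of_real (1 / (real n * \<delta>))) *\<^sub>C x"
  have k: "star k = - k"
    using scaleC_add_left[of "\<i> * complex_of_real (1 / (real n * \<delta>))" "- (\<i> * complex_of_real (1 / (real n * \<delta>)))" x]
    by (simp add: k_def star_scaleC x eq_neg_iff_add_eq_0 add.commute)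
  have "norm k = norm x / (real n * \<delta>)"
    using n0 \<delta> by (simp add: k_def norm_scaleC norm_mult norm_divide)
  moreover have "norm x < real n * \<delta>" using n \<delta> by (simp add: pos_divide_less_eq)
  ultimately have "norm k < 1" using n0 \<delta> by (simp add: pos_divide_less_eq)
  from resolvent_multiple[OF k this, of n] obtain c
    where c: "real n *\<^sub>R k = c + (real n *\<^sub>R k) * c" "real n *\<^sub>R k = c + c * (real n *\<^sub>R k)" by blast
  have sk: "star (real n *\<^sub>R k) = - (real n *\<^sub>R k)"
    by (simp add: scaleR_scaleC star_scaleC k scaleC_minus_right)
  note b = resolvent_bounds[OF resolvent_identity[OF sk c]]
  have nk: "real n *\<^sub>R k = (\<i> / \<delta>) *\<^sub>C x"
    using n0 by (simp add: k_def scaleR_scaleC scaleC_scaleC field_simps)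
  have "c = (\<i> / \<delta>) *\<^sub>C (x - c * x)"
    using c(2) by (simp add: nk scaleC_diff_right mult_scaleC_right algebra_simps)
  then have "norm c = cmod (\<i> / \<delta>) * norm (x - c * x)" by (metis norm_scaleC)
  also have "cmod (\<i> / \<delta>) = 1 / \<delta>" using \<delta> by (simp add: norm_divide)
  finally have "norm c = norm (x - c * x) / \<delta>" by simp
  then have "norm (x - c * x) \<le> \<delta>" using b(1) \<delta>
by simp
  with b that show thesis by blast
qed

text \<open>
  The set is exhausted one element at a time: if \<open>e\<close> works for \<open>F\<close> and \<open>c\<close> works for the remainder
  \<open>(1 - e) a\<close>, then the element \<open>E\<close> with \<open>1 - E = (1 - c) (1 - e)\<close> works for \<open>F\<close> and \<open>a\<close>.
\<close>

lemma left_approximate_unit: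
  fixes F :: "'a::cstar_algebra set"
  assumes "finite F" and \<delta>: "\<delta> > 0"
  shows "\<exists>e. contractive_complement e \<and> (\<forall>b\<in>F. norm (b - e * b) \<le> \<delta>)"
  using assms(1)
proof (induction F)
  case empty
  show ?case by (rule exI[of _ 0]) (simp add: contractive_complement_def)
next
  case (insert a F)
  then obtain e where e: "contractive_complement e" "\<And>b. b \<in> F \<Longrightarrow> norm (b - e * b) \<le> \<delta>" by blast
  define b where "b = a - e * a"
  \<comment> \<open>An element that almost fixes \<open>b b\<^sup>*\<close> almost fixes \<open>b\<close>, by the C*-identity.\<close>
  have sa: "star (b * star b) = b * star b" by (simp add: star_mult star_star)
  obtain c where c: "contractive_complement c" "norm c \<le> 1"
      "norm (b * star b - c * (b * star b)) \<le> \<delta>\<^sup>2 / 2"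
    using selfadjoint_approximate_unit[OF sa, of "\<delta>\<^sup>2 / 2"] \<delta> by auto
  define y where "y = b * star b - c * (b * star b)"
  have "star (star (b - c * b)) * star (b - c * b) = y - y * star c"
    by (simp add: star_star y_def star_diff star_mult algebra_simps)
  then have "(norm (b - c * b))\<^sup>2 = norm (y - y * star c)"
    using cstar_identity[of "star (b - c * b)"] by (simp add: norm_star)
  also have "\<dots> \<le> norm y + norm y * norm (star c)"
    by (meson add_left_mono norm_mult_ineq norm_triangle_ineq4 order_trans)
  also have "\<dots> \<le> \<delta>\<^sup>2" using c(2,3) mult_mono[of "norm y" "\<delta>\<^sup>2 / 2" "norm c" 1]
    by (simp add: norm_star y_def)
  finally have small: "norm (b - c * b) \<le> \<delta>"
    using \<delta> power2_le_imp_le less_imp_le by blast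
  define E where "E = e + c - c * e"
  have E: "x - E * x = (x - e * x) - c * (x - e * x)" for x
    by (simp add: E_def algebra_simps)
  have cc: "norm (x - c * x) \<le> norm x" for x using c(1) by (simp add: contractive_complement_def)
  have "contractive_complement E" unfolding contractive_complement_def
  proof
    fix x
    have "norm (x - E * x) \<le> norm (x - e * x)" unfolding E by (rule cc)
    also have "\<dots> \<le> norm x" using e(1) by (simp add: contractive_complement_def)
    finally show "norm (x - E * x) \<le> norm x" .
  qed
  moreover have "norm (x - E * x) \<le> \<delta>" if "x \<in> insert a F" for x
  proof (cases "x = a")
    case True
    then show ?thesis using small by (simp only: E b_def)
  next
    case False
    have "norm (x - E * x) \<le> norm (x - e * x)" unfolding E by (rule cc)
    also have "\<dots> \<le> \<delta>" using e(2) that False by blast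
    finally show ?thesis .
  qed
  ultimately show ?case by blast
qed

text \<open>
  If \<open>(1 - E) b\<close> and \<open>(1 - E) b\<^sup>*\<close> are small, then the self-adjoint element \<open>e\<close> with
  \<open>1 - e = (1 - E\<^sup>*) (1 - E)\<close> is an approximate unit on both sides. The constant \<open>8\<close> is the crude bound
  that follows from \<open>norm E \<le> 2\<close>.
\<close>

lemma approximate_unit:
  fixes F :: "'a::cstar_algebra set"
  assumes "finite F" and "\<delta> > 0"
  obtains e where "star e = e" "norm e \<le> 8"
    "\<And>b. b \<in> F \<Longrightarrow> norm (b - e * b) \<le> \<delta>" "\<And>b. b \<in> F \<Longrightarrow> norm (b - b * e) \<le> \<delta>"
proof -
  have "finite (F \<union> star ` F)" "\<delta> / 3 > 0" using assms by auto
  from left_approximate_unit[OF this] obtain E where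
    E: "contractive_complement E" "\<And>b. b \<in> F \<union> star ` F \<Longrightarrow> norm (b - E * b) \<le> \<delta> / 3" by blast
  have "norm (E * star E) \<le> 2 * norm (star E)"
  proof -
    have "norm (star E - E * star E) \<le> norm (star E)"
      using E(1) by (simp add: contractive_complement_def)
    then show ?thesis using norm_triangle_ineq4[of "star E" "star E - E * star E"] by simp
  qed
  then have "norm E * norm E \<le> 2 * norm E"
    using cstar_identity[of "star E"] by (simp add: star_star norm_star power2_eq_square)
  then have n2: "norm E \<le> 2" by (cases "E = 0") (auto simp: mult_le_cancel_right)
  define e where "e = E + star E - star E * E"
  have "star e = e" by (simp add: e_def star_diff star_add star_mult star_star add.commute)
  moreover have "norm e \<le> 8"
  proof -
    have "norm (star E * E) \<le> 4"
      using power_mono[OF n2, of 2] by (simp add: cstar_identity)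
    then show ?thesis unfolding e_def
      using norm_triangle_ineq[of E "star E"] norm_triangle_ineq4[of "E + star E" "star E * E"] n2
      by (simp add: norm_star)
  qed
  moreover have "norm (b - e * b) \<le> \<delta>" if "b \<in> F" for b
  proof -
    define y where "y = b - E * b"
    have y: "norm y \<le> \<delta> / 3" using that E(2) by (simp add: y_def)
    have "b - e * b = y - star E * y" by (simp add: e_def y_def algebra_simps)
    also have "norm \<dots> \<le> norm y + norm (star E) * norm y"
      by (meson add_left_mono norm_mult_ineq norm_triangle_ineq4 order_trans)
    also have "\<dots> \<le> \<delta>" using y n2 mult_mono[of "norm E" 2 "norm y" "\<delta> / 3"]
      by (simp add: norm_star)
    finally show ?thesis .
  qed
  moreover have "norm (b - b * e) \<le> \<delta>" if "b \<in> F" for b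
  proof -
    define y where "y = b - b * star E"
    have "y = star (star b - E * star b)" by (simp add: y_def star_diff star_mult star_star)
    then have y: "norm y \<le> \<delta> / 3" using that E(2)[of "star b"] by (simp add: norm_star)
    have "b - b * e = y - y * E" by (simp add: e_def y_def algebra_simps)
    also have "norm \<dots> \<le> norm y + norm y * norm E"
      by (meson add_left_mono norm_mult_ineq norm_triangle_ineq4 order_trans)
    also have "\<dots> \<le> \<delta>" using y n2 mult_mono[of "norm E" 2 "norm y" "\<delta> / 3"]
      by (simp add: mult.commute)
    finally show ?thesis .
  qed
  ultimately show thesis using that by blast
qed

section \<open>Averages of contractions\<close>

text \<open>
  The identity is an extreme point among the contractions. Suppose that \<open>y = T i x - x\<close> is nonzero.
  Expanding \<open>m ^ j *\<^sub>R y\<close> into words of length \<open>j\<close> in the contractions, where \<open>m\<close> is their number,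
  expresses this vector as a sum of \<open>m ^ j\<close> vectors of norm at most \<open>norm y\<close>. So there is no cancellation
  between the words, nor between the powers of \<open>T i\<close> applied to \<open>y\<close>: the norm of
  \<open>(\<Sum>j<n. (T i ^^ j) y)\<close> is at least \<open>n * norm y\<close>. But this sum telescopes to \<open>(T i ^^ n) x - x\<close>,
  which is bounded.
\<close>

lemma average_of_contractions_is_identity:
  fixes T :: "'i \<Rightarrow> 'v::real_normed_vector \<Rightarrow> 'v"
  assumes S: "subspace S" and fin: "finite I"
    and lin: "\<And>i. i \<in> I \<Longrightarrow> linear (T i)"
    and inS: "\<And>i x. i \<in> I \<Longrightarrow> x \<in> S \<Longrightarrow> T i x \<in> S"
    and contr: "\<And>i x. i \<in> I \<Longrightarrow> x \<in> S \<Longrightarrow> norm (T i x) \<le> norm x"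
    and avg: "\<And>x. x \<in> S \<Longrightarrow> (\<Sum>i\<in>I. T i x) = real (card I) *\<^sub>R x"
    and i: "i \<in> I" and x: "x \<in> S"
  shows "T i x = x"
proof -
  define m where "m = real (card I)"
  have m1: "m \<ge> 1" using i fin unfolding m_def
    by (metis One_nat_def Suc_leI card_gt_0_iff empty_iff of_nat_1 of_nat_le_iff)
  define y where "y = T i x - x"
  define z where "z j = (T i ^^ j) y" for j
  have yS: "y \<in> S" using S i inS x by (simp add: y_def subspace_diff)
  have zS: "z j \<in> S" for j by (induction j) (auto simp: z_def yS inS i)
  have nz: "norm (z j) \<le> norm y" for j
    by (induction j) (use contr[OF i] zS in \<open>auto simp: z_def intro: order_trans\<close>)
  \<comment> \<open>\<open>m ^ j *\<^sub>R y - z j\<close> is the sum of the other \<open>m ^ j - 1\<close> words applied to \<open>y\<close>.\<close>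
  have far: "norm (m ^ j *\<^sub>R y - z j) \<le> (m ^ j - 1) * norm y" for j
  proof (induction j)
    case (Suc j)
    have "m *\<^sub>R z j = T i (z j) + (\<Sum>l\<in>I - {i}. T l (z j))"
      using avg[OF zS[of j]] i fin by (simp add: sum.remove m_def)
    then have eq: "m ^ Suc j *\<^sub>R y - z (Suc j) = m *\<^sub>R (m ^ j *\<^sub>R y - z j) + (\<Sum>l\<in>I - {i}. T l (z j))"
      by (simp add: z_def scaleR_diff_right algebra_simps)
    have "norm (\<Sum>l\<in>I - {i}. T l (z j)) \<le> real (card (I - {i})) * norm y"
      using contr[OF _ zS[of j]] nz[of j] by (intro sum_norm_bound) (meson DiffD1 order_trans)
    also have "real (card (I - {i})) = m - 1"
      using i fin m1 by (simp add: m_def card_Diff_singleton of_nat_diff)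
    finally have s: "norm (\<Sum>l\<in>I - {i}. T l (z j)) \<le> (m - 1) * norm y" .
    have "norm (m *\<^sub>R (m ^ j *\<^sub>R y - z j)) \<le> m * ((m ^ j - 1) * norm y)"
      using Suc m1 by simp
    with s have "norm (m ^ Suc j *\<^sub>R y - z (Suc j)) \<le> m * ((m ^ j - 1) * norm y) + (m - 1) * norm y"
      unfolding eq by (intro norm_triangle_mono)
    then show ?case by (simp add: algebra_simps)
  qed (simp add: z_def)
  have tele: "(\<Sum>j<n. z j) = (T i ^^ n) x - x" for n
  proof (induction n)
    case (Suc n)
    have lin': "linear (T i ^^ n)" for n
      by (induction n) (auto simp: id_def[symmetric] linear_id intro: linear_compose lin[OF i] simp del: o_apply)
    have "z n = (T i ^^ n) (T i x) - (T i ^^ n) x"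
      by (simp add: z_def y_def linear_diff[OF lin'])
    then show ?case using Suc by (simp add: funpow_swap1)
  qed simp
  have orbit: "norm ((T i ^^ n) x) \<le> norm x \<and> (T i ^^ n) x \<in> S" for n
    by (induction n) (use contr[OF i] inS[OF i] x in \<open>auto intro: order_trans\<close>)
  have bound: "real n * norm y \<le> 2 * norm x" for n
  proof -
    define M where "M = (\<Sum>j<n. m ^ j)"
    have M: "M \<ge> 0" using m1 by (auto simp: M_def intro: sum_nonneg)
    have "norm (M *\<^sub>R y - (\<Sum>j<n. z j)) = norm (\<Sum>j<n. m ^ j *\<^sub>R y - z j)"
      by (simp add: M_def sum_subtractf scaleR_left.sum)
    also have "\<dots> \<le> (\<Sum>j<n. (m ^ j - 1) * norm y)" by (intro sum_norm_le far)
    also have "\<dots> = (M - real n) * norm y"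
      by (simp add: M_def sum_distrib_right[symmetric] sum_subtractf)
    finally have "norm (M *\<^sub>R y) - norm (\<Sum>j<n. z j) \<le> (M - real n) * norm y"
      using norm_triangle_ineq2 order_trans by blast
    moreover have "norm (\<Sum>j<n. z j) \<le> 2 * norm x"
      unfolding tele using norm_triangle_ineq4[of "(T i ^^ n) x" x] orbit[of n] by linarith
    ultimately show ?thesis using M by (simp add: algebra_simps)
  qed
  have "norm y = 0"
  proof (rule ccontr)
    assume "norm y \<noteq> 0"
    then have "norm y > 0" by simp
    obtain n where "real n > 2 * norm x / norm y" using reals_Archimedean2 by blast
    then show False using bound[of n] \<open>norm y > 0\<close> by (simp add: pos_divide_less_eq)
  qed
  then show ?thesis by (simp add: y_def)
qed

section \<open>The norm of the sequence algebra\<close>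

text \<open>
  The limit superior of the norms, as the infimum of the eventual upper bounds; this form stays
  within the real numbers and is meaningful for bounded sequences only.
\<close>

definition limsup_norm :: "(nat \<Rightarrow> 'b::real_normed_vector) \<Rightarrow> real"
  where "limsup_norm x = Inf {K. \<forall>\<^sub>F n in sequentially. norm (x n) \<le> K}"

lemma limsup_norm_le:
  assumes "\<forall>\<^sub>F n in sequentially. norm (x n) \<le> K"
  shows "limsup_norm x \<le> K"
  unfolding limsup_norm_def
proof (rule cInf_lower)
  show "bdd_below {K. \<forall>\<^sub>F n in sequentially. norm (x n) \<le> K}"
  proof (rule bdd_belowI[of _ 0])
    fix K assume "K \<in> {K. \<forall>\<^sub>F n in sequentially. norm (x n) \<le> K}"
    then obtain n where "norm (x n) \<le> K" using eventually_happens' sequentially_bot by blast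
    then show "0 \<le> K" using norm_ge_zero order_trans by blast
  qed
qed (use assms in simp)

lemma eventually_norm_le:
  assumes "Bseq x" and "limsup_norm x < K"
  shows "\<forall>\<^sub>F n in sequentially. norm (x n) \<le> K"
proof -
  obtain B where "\<And>n. norm (x n) \<le> B" using assms(1) by (auto simp: Bseq_def)
  then have "{K. \<forall>\<^sub>F n in sequentially. norm (x n) \<le> K} \<noteq> {}"
    using always_eventually by blast
  from cInf_lessD[OF this] assms(2) obtain L
    where L: "\<forall>\<^sub>F n in sequentially. norm (x n) \<le> L" "L < K"
    unfolding limsup_norm_def by blast
  show ?thesis using L(1) by eventually_elim (use L(2) in linarith)
qed

lemma limsup_norm_nonneg:
  assumes "Bseq x" shows "0 \<le> limsup_norm x"
proof (rule ccontr)
  assume neg: "\<not> 0 \<le> limsup_norm x"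
  then have "\<forall>\<^sub>F n in sequentially. norm (x n) \<le> limsup_norm x / 2"
    by (intro eventually_norm_le assms) auto
  then obtain n where "norm (x n) \<le> limsup_norm x / 2"
    using eventually_happens' sequentially_bot by blast
  then show False using neg norm_ge_zero[of "x n"] by linarith
qed

lemma limsup_norm_triangle:
  assumes "Bseq x" "Bseq y"
  shows "limsup_norm (\<lambda>n. x n + y n) \<le> limsup_norm x + limsup_norm y"
proof (rule field_le_epsilon)
  fix e :: real assume "e > 0"
  then have "\<forall>\<^sub>F n in sequentially. norm (x n) \<le> limsup_norm x + e / 2"
    "\<forall>\<^sub>F n in sequentially. norm (y n) \<le> limsup_norm y + e / 2"
    by (auto intro!: eventually_norm_le assms)
  then have "\<forall>\<^sub>F n in sequentially. norm (x n + y n) \<le> limsup_norm x + limsup_norm y + e"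
  proof eventually_elim
    case (elim n)
    then show ?case using norm_triangle_ineq[of "x n" "y n"] by linarith
  qed
  then show "limsup_norm (\<lambda>n. x n + y n) \<le> limsup_norm x + limsup_norm y + e"
    by (rule limsup_norm_le)
qed

lemma limsup_norm_mult:
  fixes x y :: "nat \<Rightarrow> 'b::real_normed_algebra"
  assumes "Bseq x" "Bseq y"
  shows "limsup_norm (\<lambda>n. x n * y n) \<le> limsup_norm x * limsup_norm y"
proof -
  have "limsup_norm (\<lambda>n. x n * y n) \<le> (limsup_norm x + e) * (limsup_norm y + e)" if "e > 0" for e
  proof -
    have "\<forall>\<^sub>F n in sequentially. norm (x n) \<le> limsup_norm x + e"
      "\<forall>\<^sub>F n in sequentially. norm (y n) \<le> limsup_norm y + e"
      using that by (auto intro!: eventually_norm_le assms)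
    then have "\<forall>\<^sub>F n in sequentially. norm (x n * y n) \<le> (limsup_norm x + e) * (limsup_norm y + e)"
    proof eventually_elim
      case (elim n)
      then show ?case by (meson mult_mono norm_ge_zero norm_mult_ineq order_trans)
    qed
    then show ?thesis by (rule limsup_norm_le)
  qed
  then have "\<forall>\<^sub>F e in at_right 0. limsup_norm (\<lambda>n. x n * y n) \<le> (limsup_norm x + e) * (limsup_norm y + e)"
    by (simp add: eventually_at_right_less eventually_mono[OF eventually_at_right_less])
  moreover have "((\<lambda>e. (limsup_norm x + e) * (limsup_norm y + e)) \<longlongrightarrow> (limsup_norm x + 0) * (limsup_norm y + 0)) (at_right 0)"
    by (intro tendsto_intros)
  ultimately show ?thesis
    by (simp add: tendsto_lowerbound)
qed

lemma limsup_norm_scaleR_le: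
  assumes "Bseq x" "c \<noteq> 0"
  shows "limsup_norm (\<lambda>n. c *\<^sub>R x n) \<le> \<bar>c\<bar> * limsup_norm x"
proof (rule field_le_epsilon)
  fix e :: real assume "e > 0"
  then have "\<forall>\<^sub>F n in sequentially. norm (x n) \<le> limsup_norm x + e / \<bar>c\<bar>"
    using assms by (intro eventually_norm_le) auto
  then have "\<forall>\<^sub>F n in sequentially. norm (c *\<^sub>R x n) \<le> \<bar>c\<bar> * limsup_norm x + e"
    by eventually_elim (use assms(2) in \<open>simp add: field_simps\<close>)
  then show "limsup_norm (\<lambda>n. c *\<^sub>R x n) \<le> \<bar>c\<bar> * limsup_norm x + e"
    by (rule limsup_norm_le)
qed

lemma limsup_norm_null:
  assumes "x \<longlonglongrightarrow> 0"
  shows "limsup_norm x \<le> 0"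
proof (rule field_le_epsilon)
  fix e :: real assume "e > 0"
  then have "\<forall>\<^sub>F n in sequentially. norm (x n) < 0 + e"
    using assms by (simp add: tendsto_iff dist_norm)
  then show "limsup_norm x \<le> 0 + e" by (intro limsup_norm_le) (auto elim: eventually_mono)
qed

lemma limsup_norm_eq_zero_iff:
  assumes "Bseq x"
  shows "limsup_norm x = 0 \<longleftrightarrow> x \<longlonglongrightarrow> 0"
proof
  assume 0: "limsup_norm x = 0"
  show "x \<longlonglongrightarrow> 0" unfolding tendsto_iff dist_norm
  proof safe
    fix e :: real assume "e > 0"
    then have "\<forall>\<^sub>F n in sequentially. norm (x n) \<le> e / 2"
      using 0 assms by (intro eventually_norm_le) auto
    then show "\<forall>\<^sub>F n in sequentially. norm (x n - 0) < e"
      by eventually_elim (use \<open>e > 0\<close> in simp)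
  qed
qed (use limsup_norm_null limsup_norm_nonneg assms order_antisym in blast)

lemma limsup_norm_cong:
  assumes "seq_rel x y" shows "limsup_norm x = limsup_norm y"
proof -
  have *: "limsup_norm x \<le> limsup_norm y" if "seq_rel x y" for x y :: "nat \<Rightarrow> 'a"
  proof -
    have B: "Bseq y" "(\<lambda>n. x n - y n) \<longlonglongrightarrow> 0" using that by (auto simp: seq_rel_def)
    then have "Bseq (\<lambda>n. x n - y n)" using convergent_imp_Bseq convergent_def by blast
    from limsup_norm_triangle[OF this B(1)] limsup_norm_null[OF B(2)] show ?thesis by simp
  qed
  have "seq_rel y x" using assms part_equivp_seq_rel by (auto elim!: part_equivpE dest: sympD)
  then show ?thesis by (intro order_antisym *[OF assms] *)
qed

text \<open>
  With the quotient norm the sequence algebra becomes a normed algebra, so that the library lemmas on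
  norms of finite sums and on subspaces apply to it.
\<close>

instantiation seq_alg :: (cstar_algebra) real_normed_algebra
begin

definition scaleR_seq_alg :: "real \<Rightarrow> 'a seq_alg \<Rightarrow> 'a seq_alg"
  where "scaleR_seq_alg r x = complex_of_real r *\<^sub>C x"

lift_definition norm_seq_alg :: "'a seq_alg \<Rightarrow> real" is limsup_norm
  by (rule limsup_norm_cong)

definition sgn_seq_alg :: "'a seq_alg \<Rightarrow> 'a seq_alg"
  where "sgn_seq_alg x = inverse (norm x) *\<^sub>R x"

definition dist_seq_alg :: "'a seq_alg \<Rightarrow> 'a seq_alg \<Rightarrow> real"
  where "dist_seq_alg x y = norm (x - y)"

definition uniformity_seq_alg :: "('a seq_alg \<times> 'a seq_alg) filter"
  where "uniformity_seq_alg = (INF e\<in>{0<..}. principal {(x, y). dist x y < e})"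

definition open_seq_alg :: "'a seq_alg set \<Rightarrow> bool"
  where "open_seq_alg U \<longleftrightarrow> (\<forall>x\<in>U. \<forall>\<^sub>F (x', y) in uniformity. x' = x \<longrightarrow> y \<in> U)"

instance
proof
  fix x y z :: "'a seq_alg" and r s :: real and U :: "'a seq_alg set"
  show "dist x y = norm (x - y)" by (simp add: dist_seq_alg_def)
  show "uniformity = (INF e\<in>{0<..}. principal {(x, y :: 'a seq_alg). dist x y < e})"
    by (simp add: uniformity_seq_alg_def)
  show "open U \<longleftrightarrow> (\<forall>x\<in>U. \<forall>\<^sub>F (x', y) in uniformity. x' = x \<longrightarrow> y \<in> U)"
    by (simp add: open_seq_alg_def)
  show "sgn x = inverse (norm x) *\<^sub>R x" by (simp add: sgn_seq_alg_def)
  show "r *\<^sub>R (x + y) = r *\<^sub>R x + r *\<^sub>R y" "(r + s) *\<^sub>R x = r *\<^sub>R x + s *\<^sub>R x"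
    "r *\<^sub>R s *\<^sub>R x = (r * s) *\<^sub>R x" "1 *\<^sub>R x = x" "r *\<^sub>R x * y = r *\<^sub>R (x * y)" "x * r *\<^sub>R y = r *\<^sub>R (x * y)"
    by (simp_all add: scaleR_seq_alg_def scaleC_add_right scaleC_add_left scaleC_scaleC scaleC_one
        mult_scaleC_left mult_scaleC_right)
  have zero_iff: "norm x = 0 \<longleftrightarrow> x = 0" for x :: "'a seq_alg"
    by transfer (auto simp: limsup_norm_eq_zero_iff seq_rel_def Bseq_def intro: exI[of _ 1])
  show "norm x = 0 \<longleftrightarrow> x = 0" by (rule zero_iff)
  show "norm (x + y) \<le> norm x + norm y"
    by transfer (simp add: limsup_norm_triangle seq_rel_refl)
  show "norm (x * y) \<le> norm x * norm y"
    by transfer (simp add: limsup_norm_mult seq_rel_refl)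
  have le: "norm (r *\<^sub>R x) \<le> \<bar>r\<bar> * norm x" if "r \<noteq> 0" for r and x :: "'a seq_alg"
    using that unfolding scaleR_seq_alg_def
    by transfer (simp add: limsup_norm_scaleR_le seq_rel_refl scaleR_scaleC[symmetric])
  show "norm (r *\<^sub>R x) = \<bar>r\<bar> * norm x"
  proof (cases "r = 0")
    case True
    then show ?thesis by (simp add: scaleR_seq_alg_def zero_iff)
  next
    case False
    have "inverse r *\<^sub>R r *\<^sub>R x = x"
      using False by (simp add: scaleR_seq_alg_def scaleC_scaleC scaleC_one)
    then have "norm x \<le> \<bar>inverse r\<bar> * norm (r *\<^sub>R x)" using le[of "inverse r" "r *\<^sub>R x"] False by simp
    then show ?thesis using le[OF False, of x] False by (simp add: field_simps)
  qed
qed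

end

lemma norm_star_seq: "norm (star x) = norm (x :: 'b::cstar_algebra seq_alg)"
  by transfer (simp add: limsup_norm_def norm_star)

text \<open>
  The nontrivial inequality follows by taking square roots of the eventual bounds.
\<close>

lemma seq_alg_cstar_identity:
  fixes x :: "'b::cstar_algebra seq_alg"
  shows "norm (star x * x) = (norm x)\<^sup>2"
proof (rule order_antisym)
  show "norm (star x * x) \<le> (norm x)\<^sup>2"
    using norm_mult_ineq[of "star x" x] by (simp add: power2_eq_square norm_star_seq)
  have "limsup_norm x \<le> sqrt (limsup_norm (\<lambda>n. star (x n) * x n) + e)"
    if "Bseq x" "e > 0" for x :: "nat \<Rightarrow> 'b" and e
  proof -
    have "Bseq (\<lambda>n. star (x n) * x n)"
      by (intro Bseq_times Bseq_linear[OF bounded_linear_star] that)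
    then have "\<forall>\<^sub>F n in sequentially. norm (star (x n) * x n) \<le> limsup_norm (\<lambda>n. star (x n) * x n) + e"
      using that by (intro eventually_norm_le) auto
    then show ?thesis
      by (intro limsup_norm_le, eventually_elim) (simp add: cstar_identity real_le_rsqrt)
  qed
  then have "norm x \<le> sqrt (norm (star x * x) + e)" if "e > 0" for e
    using that by (transfer fixing: e) (simp add: seq_rel_refl)
  note * = this
  have "(norm x)\<^sup>2 \<le> norm (star x * x) + e" if "e > 0" for e
  proof -
    have "(norm x)\<^sup>2 \<le> (sqrt (norm (star x * x) + e))\<^sup>2"
      using *[OF that] by (intro power_mono) auto
    then show ?thesis using that by simp
  qed
  then show "(norm x)\<^sup>2 \<le> norm (star x * x)" by (rule field_le_epsilon)
qed

lemma norm_const_seq_le: "norm (const_seq b) \<le> norm b"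
  by transfer (simp add: limsup_norm_le)

section \<open>Multipliers and automorphisms\<close>

lemma lmul_mult: "lmul m (a * b) = lmul m a * b"
  and rmul_mult: "rmul (a * b) m = a * rmul b m"
  and rmul_lmul: "rmul a m * b = a * lmul m b"
  by (transfer, auto simp: double_centralizer_def)+

lemma lmul_diff: "lmul m (a - b) = lmul m a - lmul m b"
  by transfer (auto simp: double_centralizer_def bounded_clinear_def clinear_diff)

lemma lmul_times: "lmul (m * n) a = lmul m (lmul n a)"
  by transfer auto

lemma lmul_one [simp]: "lmul 1 a = a"
  by transfer auto

lemma lmul_scaleC: "lmul (c *\<^sub>C m) a = c *\<^sub>C lmul m a"
  by transfer auto

lemma star_lmul: "star (lmul m a) = rmul (star a) (star m)"
  by transfer (auto simp: star_star)

lemma star_one_multiplier [simp]: "star (1 :: 'a::cstar_algebra multiplier) = 1"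
  by transfer (auto simp: star_star)

lemma bounded_linear_lmul: "bounded_linear (lmul m)"
  and bounded_linear_rmul: "bounded_linear (\<lambda>a. rmul a m)"
  by (transfer, auto simp: double_centralizer_def bounded_clinear_def)+

lemma lmul_star_lmul:
  assumes "unitary m"
  shows "lmul (star m) (lmul m a) = a" and "lmul m (lmul (star m) a) = a"
  using assms by (simp_all add: unitary_def lmul_times[symmetric])

lemma norm_lmul_unitary:
  assumes "unitary m"
  shows "norm (lmul m a) = norm a"
  by (rule norm_eqI_star_mult) (simp add: star_lmul rmul_lmul lmul_star_lmul[OF assms])

lemma aut_app_hom: "star_hom (aut_app f)" and aut_app_bij: "bij (aut_app f)"
  using aut_app[of f] by auto

lemma aut_app_mult: "aut_app f (x * y) = aut_app f x * aut_app f y"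
  and aut_app_star: "aut_app f (star x) = star (aut_app f x)"
  and aut_app_diff: "aut_app f (x - y) = aut_app f x - aut_app f y"
  using aut_app_hom[of f] by (auto simp: star_hom_def intro: clinear_diff)

lemma aut_app_eq_iff [simp]: "aut_app f x = aut_app f y \<longleftrightarrow> x = y"
  by (metis aut_app_bij bij_pointE)

lemma aut_app_surj: obtains y where "aut_app f y = x"
  by (metis aut_app_bij bij_pointE)

lemma norm_aut_app [simp]: "norm (aut_app f x) = norm x"
proof (rule order_antisym)
  let ?g = "inv_into UNIV (aut_app f)"
  have "norm (?g (aut_app f x)) \<le> norm (aut_app f x)"
    using star_hom_norm_le star_hom_inv[OF aut_app_bij aut_app_hom] by blast
  then show "norm x \<le> norm (aut_app f x)"
    by (simp add: bij_is_inj[OF aut_app_bij])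
qed (rule star_hom_norm_le[OF aut_app_hom])

lemma aut_app_lmul: "aut_app f (lmul m a) = lmul (aut_multiplier f m) (aut_app f a)"
  by transfer (auto simp: bij_is_inj)

lemma aut_multiplier_star: "aut_multiplier f (star m) = star (aut_multiplier f m)"
proof (transfer, clarsimp)
  fix f L R :: "'a \<Rightarrow> 'a"
  assume f: "bij f" "star_hom f"
  have "inv_into UNIV f (star x) = star (inv_into UNIV f x)" "f (star x) = star (f x)" for x
    using f star_hom_inv[OF f] by (simp_all add: star_hom_def)
  then show "(\<lambda>a. f (star (R (star (inv_into UNIV f a))))) = (\<lambda>a. star (f (R (inv_into UNIV f (star a))))) \<and>
      (\<lambda>a. f (star (L (star (inv_into UNIV f a))))) = (\<lambda>a. star (f (L (inv_into UNIV f (star a)))))"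
    by simp
qed

lemma mult_star_eq_zeroD:
  fixes x :: "'a::cstar_algebra"
  assumes "x * star x = 0"
  shows "x = 0"
proof -
  have "norm (star x) = 0" using cstar_identity[of "star x"] assms by (simp add: star_star)
  then show ?thesis by (simp add: norm_star)
qed

section \<open>Coherent morphisms\<close>

lemma (in group) action_one:
  fixes \<gamma> :: "_ \<Rightarrow> 'c::cstar_algebra star_aut"
  assumes "anomalous_action G \<gamma> w"
  shows "aut_app (\<gamma> \<one>) x = x"
proof -
  have "rmul x (1 :: 'c multiplier) = x" for x by transfer auto
  then have "aut_app (\<gamma> \<one>) (aut_app (\<gamma> \<one>) x) = aut_app (\<gamma> \<one>) x"
    using assms by (simp add: anomalous_action_def Ad_def)
  then show ?thesis by simp
qed

text \<open>
  The two actions are kept fixed, so that several coherent morphisms between them can be considered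
  together.
\<close>

locale anomalous_pair = group G for G (structure) +
  fixes \<alpha> :: "'g \<Rightarrow> 'a::cstar_algebra star_aut" and u :: "'g \<Rightarrow> 'g \<Rightarrow> 'a multiplier"
    and \<beta> :: "'g \<Rightarrow> 'b::cstar_algebra star_aut" and v :: "'g \<Rightarrow> 'g \<Rightarrow> 'b multiplier"
  assumes \<alpha>: "anomalous_action G \<alpha> u" and \<beta>: "anomalous_action G \<beta> v"
begin

lemma u_unitary: "g \<in> carrier G \<Longrightarrow> h \<in> carrier G \<Longrightarrow> unitary (u g h)"
  and u_one [simp]: "g \<in> carrier G \<Longrightarrow> u g \<one> = 1" "g \<in> carrier G \<Longrightarrow> u \<one> g = 1"
  using \<alpha> by (auto simp: anomalous_action_def)

lemma v_unitary: "g \<in> carrier G \<Longrightarrow> h \<in> carrier G \<Longrightarrow> unitary (v g h)"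
  and v_one [simp]: "g \<in> carrier G \<Longrightarrow> v g \<one> = 1" "g \<in> carrier G \<Longrightarrow> v \<one> g = 1"
  using \<beta> by (auto simp: anomalous_action_def)

lemma \<beta>_\<beta>: "g \<in> carrier G \<Longrightarrow> h \<in> carrier G \<Longrightarrow>
    aut_app (\<beta> g) (aut_app (\<beta> h) b) = rmul (lmul (v g h) (aut_app (\<beta> (g \<otimes> h)) b)) (star (v g h))"
  using \<beta> by (auto simp: anomalous_action_def Ad_def)

lemmas \<alpha>_one [simp] = action_one[OF \<alpha>]
lemmas \<beta>_one [simp] = action_one[OF \<beta>]

text \<open>
  The cocycle moves past the iterated action; no unitary is left on the right because it meets
  its inverse.
\<close>

lemma \<beta>_\<beta>_lmul:
  assumes "g \<in> carrier G" "h \<in> carrier G"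
  shows "aut_app (\<beta> g) (aut_app (\<beta> h) b) * lmul (v g h) c
    = lmul (v g h) (aut_app (\<beta> (g \<otimes> h)) b * c)"
  by (simp add: \<beta>_\<beta> rmul_lmul lmul_star_lmul v_unitary assms lmul_mult)

text \<open>
  The anomaly at \<open>(h, h\<inverse>, h)\<close>, where the two unitaries that involve a product of group elements are
  trivial.
\<close>

lemma \<beta>_v_inv:
  assumes h: "h \<in> carrier G"
  obtains z where "aut_multiplier (\<beta> h) (v (inv h) h) = z *\<^sub>C v h (inv h)"
proof -
  obtain z where z: "anomaly_multiplier G \<beta> v h (inv h) h = z *\<^sub>C 1"
    using \<beta> h unfolding anomalous_action_def by (meson inv_closed)
  let ?m = "aut_multiplier (\<beta> h) (v (inv h) h)"
  have "?m * star (v h (inv h)) = z *\<^sub>C 1"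
    using z h by (simp add: anomaly_multiplier_def)
  then have "?m * star (v h (inv h)) * v h (inv h) = z *\<^sub>C v h (inv h)"
    by (simp add: mult_scaleC_left)
  then have "?m = z *\<^sub>C v h (inv h)"
    using v_unitary[of h "inv h"] h by (simp add: unitary_def mult.assoc)
  with that show thesis by blast
qed

end

locale coherent_map = anomalous_pair +
  fixes \<phi>
  assumes coherent: "Defs.coherent_morphism G \<alpha> u \<beta> v \<phi>"
begin

lemma inner_product: "g \<in> carrier G \<Longrightarrow> star (\<phi> g a) * \<phi> g b = \<phi> \<one> (star a * b)"
  and compose: "g \<in> carrier G \<Longrightarrow> h \<in> carrier G \<Longrightarrow>
    \<phi> (g \<otimes> h) (lmul (star (u g h)) (aut_app (\<alpha> g) a * b)) =
    lmul (star (v g h)) (aut_app (\<beta> g) (\<phi> h a) * \<phi> g b)"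
  and lin: "g \<in> carrier G \<Longrightarrow> clinear (\<phi> g)"
  using coherent by (auto simp: Defs.coherent_morphism_def)

lemma left_module: "g \<in> carrier G \<Longrightarrow> aut_app (\<beta> g) (\<phi> \<one> a) * \<phi> g b = \<phi> g (aut_app (\<alpha> g) a * b)"
  using compose[of g \<one> a b] by simp

lemma right_module: "h \<in> carrier G \<Longrightarrow> \<phi> h a * \<phi> \<one> b = \<phi> h (a * b)"
  using compose[of \<one> h a b] by simp

lemma compose_lmul: "g \<in> carrier G \<Longrightarrow> h \<in> carrier G \<Longrightarrow>
    aut_app (\<beta> g) (\<phi> h a) * \<phi> g b = lmul (v g h) (\<phi> (g \<otimes> h) (lmul (star (u g h)) (aut_app (\<alpha> g) a * b)))"
  by (simp add: compose lmul_star_lmul v_unitary)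

text \<open>
  Multiplicativity is the coherence relation at the unit. Compatibility with \<open>star\<close> is hidden in
  the relation for inner products: it shows that the defect \<open>d\<close> annihilates the range from the left,
  and the C*-identity then forces \<open>d * star d = 0\<close>.
\<close>

lemma star_hom_one: "star_hom (\<phi> \<one>)"
  unfolding star_hom_def
proof (intro conjI allI)
  show "clinear (\<phi> \<one>)" by (simp add: lin)
  show "\<phi> \<one> (x * y) = \<phi> \<one> x * \<phi> \<one> y" for x y by (simp add: right_module)
  fix a
  define d where "d = \<phi> \<one> (star a) - star (\<phi> \<one> a)"
  have d: "d * \<phi> \<one> b = 0" for b
    by (simp add: d_def left_diff_distrib inner_product right_module)
  define y where "y = star (\<phi> \<one> (star a))"
  have "d * y * star (d * y) = d * (y * star y) * star d" by (simp add: star_mult mult.assoc)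
  also have "\<dots> = 0" by (simp add: y_def star_star inner_product d)
  finally have "d * y = 0" by (rule mult_star_eq_zeroD)
  moreover have "star d = y - \<phi> \<one> a" by (simp add: d_def y_def star_diff star_star)
  ultimately have "d * star d = 0" by (simp add: right_diff_distrib d)
  then have "d = 0" by (rule mult_star_eq_zeroD)
  then show "\<phi> \<one> (star a) = star (\<phi> \<one> a)" by (simp add: d_def)
qed

lemma norm_le: "g \<in> carrier G \<Longrightarrow> norm (\<phi> g a) \<le> norm a"
proof -
  assume g: "g \<in> carrier G"
  have "(norm (\<phi> g a))\<^sup>2 = norm (\<phi> \<one> (star a * a))" by (simp add: cstar_identity[symmetric] inner_product g)
  also have "\<dots> \<le> norm (star a * a)" by (rule star_hom_norm_le[OF star_hom_one])
  finally show ?thesis by (simp add: cstar_identity)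
qed

text \<open>
  The range of \<open>\<beta> h \<circ> \<phi> \<one>\<close> lies in the closed right ideal generated by the range of \<open>\<phi> h\<close>: coherence at
  \<open>(h\<inverse>, h)\<close> writes \<open>\<phi> \<one> (a * b)\<close> with a factor \<open>\<beta> (inv h) (\<phi> h a')\<close>, and \<open>\<beta> h\<close> turns that factor into
  \<open>\<phi> h a'\<close> up to the cocycle, where the anomaly leaves a scalar. Products are enough, as the C*-identity
  replaces an arbitrary \<open>c\<close> by \<open>c * star c\<close>. In terms of the operators \<open>s h\<close> of
  the introduction, this is what makes them unitary and not only isometric.
\<close>

lemma left_annihilator_range:
  assumes h: "h \<in> carrier G" and d: "\<And>a. d * \<phi> h a = 0"
  shows "d * aut_app (\<beta> h) (\<phi> \<one> c) = 0"
proof -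
  let ?k = "inv h"
  have k: "?k \<in> carrier G" using h by simp
  obtain z where z: "aut_multiplier (\<beta> h) (v ?k h) = z *\<^sub>C v h ?k"
    using \<beta>_v_inv[OF h] by blast
  have product: "d * aut_app (\<beta> h) (\<phi> \<one> (a * b)) = 0" for a b
  proof -
    obtain a' where a': "aut_app (\<alpha> ?k) a' = lmul (u ?k h) a" by (rule aut_app_surj)
    have "\<phi> \<one> (a * b) = lmul (star (v ?k h)) (aut_app (\<beta> ?k) (\<phi> h a') * \<phi> ?k b)"
      using compose[OF k h, of a' b] h k by (simp add: a' lmul_mult lmul_star_lmul u_unitary)
    then have "aut_app (\<beta> h) (\<phi> \<one> (a * b))
        = cnj z *\<^sub>C lmul (star (v h ?k)) (aut_app (\<beta> h) (aut_app (\<beta> ?k) (\<phi> h a')) * aut_app (\<beta> h) (\<phi> ?k b))"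
      by (simp add: aut_app_lmul aut_multiplier_star z star_scaleC lmul_scaleC aut_app_mult)
    also have "\<dots> = cnj z *\<^sub>C (\<phi> h a' * lmul (star (v h ?k)) (aut_app (\<beta> h) (\<phi> ?k b)))"
      using h k by (simp add: \<beta>_\<beta> rmul_lmul lmul_mult lmul_star_lmul v_unitary)
    finally show ?thesis by (simp add: mult_scaleC_right mult.assoc[symmetric] d)
  qed
  let ?y = "aut_app (\<beta> h) (\<phi> \<one> c)"
  have "?y * star ?y = aut_app (\<beta> h) (\<phi> \<one> (c * star c))"
    using star_hom_one by (simp add: star_hom_def aut_app_mult aut_app_star)
  then have "d * ?y * star (d * ?y) = d * aut_app (\<beta> h) (\<phi> \<one> (c * star c)) * star d"
    by (simp only: star_mult mult.assoc) (simp only: mult.assoc[symmetric])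
  also have "\<dots> = 0" by (simp add: product)
  finally show ?thesis by (rule mult_star_eq_zeroD)
qed

text \<open>
  The counterpart of the inner product relation: \<open>s h * \<phi> \<one> (a * b\<^sup>*) * (s h)\<^sup>*\<close> is the value of
  \<open>\<beta> h \<circ> \<phi> \<one> \<circ> (\<alpha> h)\<inverse>\<close>. The difference \<open>d\<close> of both sides annihilates the range of \<open>\<phi> h\<close>, hence also
  the range of \<open>\<beta> h \<circ> \<phi> \<one>\<close>, and so \<open>d * star d = 0\<close>.
\<close>

lemma outer_product:
  assumes h: "h \<in> carrier G" and c: "aut_app (\<alpha> h) c = a * star b"
  shows "\<phi> h a * star (\<phi> h b) = aut_app (\<beta> h) (\<phi> \<one> c)"
proof -
  define d where "d = \<phi> h a * star (\<phi> h b) - aut_app (\<beta> h) (\<phi> \<one> c)"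
  have d: "d * \<phi> h x = 0" for x
    by (simp add: d_def left_diff_distrib mult.assoc inner_product right_module left_module c h)
  have "d * aut_app (\<beta> h) (\<phi> \<one> (star c)) = 0" by (rule left_annihilator_range[OF h d])
  moreover have "star (aut_app (\<beta> h) (\<phi> \<one> c)) = aut_app (\<beta> h) (\<phi> \<one> (star c))"
    using star_hom_one by (simp add: star_hom_def aut_app_star)
  ultimately have "d * star d = d * (\<phi> h b * star (\<phi> h a))"
    by (simp add: d_def star_diff star_mult star_star right_diff_distrib)
  also have "\<dots> = 0" by (simp add: mult.assoc[symmetric] d)
  finally have "d = 0" by (rule mult_star_eq_zeroD)
  then show ?thesis by (simp add: d_def)
qed

end

section \<open>Automorphisms, multipliers and units in the sequence algebra\<close>

lemma abs_seq_alg_eqI: "seq_rel x y \<Longrightarrow> abs_seq_alg x = abs_seq_alg y"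
  by (rule Quotient3_rel_abs[OF Quotient3_seq_alg])

lemma aut_seq_abs:
  assumes "Bseq y"
  shows "aut_seq f (abs_seq_alg y) = abs_seq_alg (\<lambda>n. aut_app f (y n))"
proof -
  have "bij (aut_app f)" "star_hom (aut_app f)" by (rule aut_app_bij aut_app_hom)+
  then show ?thesis
  using aut_seq.abs_eq[of "aut_app f" y] assms by (auto simp: seq_rel_refl aut_app_inverse eq_onp_def)
qed

lemma seq_alg_cases:
  obtains x where "Bseq x" "X = abs_seq_alg x"
  by (metis Quotient3_abs_rep Quotient3_rep_reflp Quotient3_seq_alg seq_rel_refl)

lemma eventually_norm_less:
  assumes "Bseq x" and "norm (abs_seq_alg x) < \<epsilon>"
  shows "\<forall>\<^sub>F n in sequentially. norm (x n) < \<epsilon>"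
proof -
  obtain r where r: "norm (abs_seq_alg x) < r" "r < \<epsilon>" using dense assms(2) by blast
  have "norm (abs_seq_alg x) = limsup_norm x"
    by (rule norm_seq_alg.abs_eq) (simp add: seq_rel_refl assms)
  then have "\<forall>\<^sub>F n in sequentially. norm (x n) \<le> r" using r assms(1) by (intro eventually_norm_le) auto
  then show ?thesis by eventually_elim (use r in linarith)
qed

lemma aut_seq_mult: "aut_seq f (x * y) = aut_seq f x * aut_seq f y"
  and aut_seq_star: "aut_seq f (star x) = star (aut_seq f x)"
  and aut_seq_add: "aut_seq f (x + y) = aut_seq f x + aut_seq f y"
  using star_hom_aut_seq[of f] by (auto simp: star_hom_def intro: clinear_add)

lemma aut_seq_sum: "aut_seq f (sum x I) = (\<Sum>i\<in>I. aut_seq f (x i))"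
proof -
  have "aut_seq f 0 = 0" using aut_seq_add[of f 0 0] by simp
  then show ?thesis by (induction I rule: infinite_finite_induct) (auto simp: aut_seq_add)
qed

lemma Bseq_const: "Bseq (\<lambda>n. b :: 'b::real_normed_vector)"
  by (rule BseqI'[where K = "norm b"]) simp

lemma const_seq_mult: "const_seq (a * b) = const_seq a * const_seq b"
  by transfer (simp add: seq_rel_refl Bseq_const)

lemma Bseq_diff: "Bseq x \<Longrightarrow> Bseq y \<Longrightarrow> Bseq (\<lambda>n. x n - y n :: 'b::cstar_algebra)"
  using Bseq_plus[of x "\<lambda>n. - y n"] by (simp add: Bseq_minus_iff)

lemma abs_seq_alg_diff:
  assumes "Bseq x" and "Bseq y"
  shows "abs_seq_alg x - abs_seq_alg y = abs_seq_alg (\<lambda>n. x n - y n)"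
proof -
  have "abs_seq_alg (\<lambda>n. x n - y n) + abs_seq_alg y = abs_seq_alg x"
    using assms by (simp add: plus_seq_alg.abs_eq seq_rel_refl Bseq_diff)
  then show ?thesis by (simp add: algebra_simps)
qed

lemma const_seq_diff: "const_seq (a - b) = const_seq a - const_seq b"
  by (simp add: const_seq.abs_eq abs_seq_alg_diff Bseq_const)

lemma rel_commutantD: "x \<in> rel_commutant \<Longrightarrow> x * const_seq b = const_seq b * x"
  by (simp add: rel_commutant_def)

lemma rel_commutant_sum: "(\<And>i. i \<in> I \<Longrightarrow> x i \<in> rel_commutant) \<Longrightarrow> sum x I \<in> rel_commutant"
  by (induction I rule: infinite_finite_induct) (auto simp: zero_rel_commutant rel_commutant_closed)

lemma aut_seq_rel_commutant:
  assumes "x \<in> rel_commutant"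
  shows "aut_seq f x \<in> rel_commutant"
  unfolding rel_commutant_def
proof safe
  fix b
  obtain b' where b': "aut_app f b' = b" by (rule aut_app_surj)
  have "aut_seq f (x * const_seq b') = aut_seq f (const_seq b' * x)"
    using rel_commutantD[OF assms] by simp
  then show "aut_seq f x * const_seq b = const_seq b * aut_seq f x"
    by (simp add: aut_seq_mult aut_seq_const_seq b')
qed

lift_definition lmul_seq :: "'b::cstar_algebra multiplier \<Rightarrow> 'b seq_alg \<Rightarrow> 'b seq_alg"
  is "\<lambda>m x n. lmul m (x n)"
  by (rule seq_rel_linear[OF bounded_linear_lmul])

lift_definition rmul_seq :: "'b::cstar_algebra seq_alg \<Rightarrow> 'b multiplier \<Rightarrow> 'b seq_alg"
  is "\<lambda>x m n. rmul (x n) m"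
  by (rule seq_rel_linear[OF bounded_linear_rmul])

lemma lmul_seq_const: "lmul_seq m (const_seq c * x) = const_seq (lmul m c) * x"
  and rmul_seq_const: "rmul_seq (x * const_seq c) m = x * const_seq (rmul c m)"
proof -
  obtain y where y: "Bseq y" "x = abs_seq_alg y" by (rule seq_alg_cases)
  then show "lmul_seq m (const_seq c * x) = const_seq (lmul m c) * x"
    "rmul_seq (x * const_seq c) m = x * const_seq (rmul c m)"
    by (simp_all add: const_seq.abs_eq times_seq_alg.abs_eq lmul_seq.abs_eq rmul_seq.abs_eq
        seq_rel_refl Bseq_const Bseq_times lmul_mult rmul_mult)
qed

text \<open>
  Inner automorphisms act trivially on central sequences, also when the implementing unitary is only
  a multiplier: \<open>m\<close> multiplies the constant next to it, and the central sequence is moved out of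
  the way.
\<close>

lemma aut_seq_compose_Ad:
  fixes f f' f'' :: "'b::cstar_algebra star_aut"
  assumes Ad: "\<And>b. aut_app f (aut_app f' b) = Ad m (aut_app f'' b)"
    and P: "P \<in> rel_commutant"
  shows "aut_seq f (aut_seq f' P) * const_seq b = aut_seq f'' P * const_seq b"
proof -
  have Ad_seq: "aut_seq f (aut_seq f' x) = rmul_seq (lmul_seq m (aut_seq f'' x)) (star m)" for x
  proof -
    obtain y where y: "Bseq y" "x = abs_seq_alg y" by (rule seq_alg_cases)
    show ?thesis using Ad y
      by (simp add: aut_seq_abs lmul_seq.abs_eq rmul_seq.abs_eq seq_rel_refl Ad_def
          Bseq_linear[OF bounded_linear_lmul] Bseq_linear[OF star_hom_bounded_linear[OF aut_app_hom]])
  qed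
  obtain b1 where b1: "aut_app f b1 = b" by (rule aut_app_surj)
  obtain b2 where b2: "aut_app f' b2 = b1" by (rule aut_app_surj)
  let ?c = "aut_app f'' b2" and ?Q = "aut_seq f'' P"
  have Q: "?Q * const_seq y = const_seq y * ?Q" for y
    by (rule rel_commutantD[OF aut_seq_rel_commutant[OF P]])
  have "aut_seq f (aut_seq f' P) * const_seq b = aut_seq f (aut_seq f' (P * const_seq b2))"
    by (simp add: aut_seq_mult aut_seq_const_seq b1 b2)
  also have "\<dots> = rmul_seq (lmul_seq m (const_seq ?c * ?Q)) (star m)"
    by (simp only: Ad_seq) (simp add: aut_seq_mult aut_seq_const_seq Q)
  also have "\<dots> = rmul_seq (?Q * const_seq (lmul m ?c)) (star m)"
    by (simp add: lmul_seq_const Q)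
  also have "\<dots> = ?Q * const_seq (Ad m ?c)" by (simp add: rmul_seq_const Ad_def)
  also have "Ad m ?c = b" using Ad[of b2] by (simp add: b1 b2)
  finally show ?thesis .
qed

text \<open>
  Separability is used to choose one sequence that serves all elements: its \<open>n\<close>-th term is an
  approximate unit for the first \<open>n + 1\<close> terms of a dense sequence, up to \<open>1 / (n + 1)\<close>.
\<close>

lemma sequential_unit:
  assumes "separable_space (euclidean :: 'b::cstar_algebra topology)"
  obtains E :: "'b::cstar_algebra seq_alg" where "\<And>b. E * const_seq b = const_seq b" "\<And>b. const_seq b * E = const_seq b"
proof -
  obtain C :: "'b set" where C: "countable C" "closure C = UNIV"
    using assms by (auto simp: separable_space_def)
  then have "C \<noteq> {}" by auto
  define d where "d = from_nat_into C"
  have d: "range d = C" unfolding d_def by (rule range_from_nat_into[OF \<open>C \<noteq> {}\<close> C(1)])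
  have "\<exists>e. norm e \<le> 8 \<and> (\<forall>b\<in>d ` {..n}. norm (b - e * b) \<le> 1 / real (Suc n) \<and> norm (b - b * e) \<le> 1 / real (Suc n))" for n
    by (rule approximate_unit[of "d ` {..n}" "1 / real (Suc n)"]) auto
  then obtain e where e8: "\<And>n. norm (e n) \<le> 8"
    and e: "\<And>n k. k \<le> n \<Longrightarrow> norm (d k - e n * d k) \<le> 1 / real (Suc n)"
      "\<And>n k. k \<le> n \<Longrightarrow> norm (d k - d k * e n) \<le> 1 / real (Suc n)"
    by (metis atMost_iff image_eqI)
  have Be: "Bseq e" using e8 by (intro BseqI'[where K = 8]) auto
  have lim: "\<forall>\<^sub>F n in sequentially. norm (e n * b - b) < \<epsilon> \<and> norm (b * e n - b) < \<epsilon>" if "\<epsilon> > 0" for b \<epsilon>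
  proof -
    have "b \<in> closure C" using C by simp
    then obtain k where k: "norm (b - d k) < \<epsilon> / 20"
      using \<open>\<epsilon> > 0\<close> d unfolding closure_approachable dist_norm
      by (metis (no_types, opaque_lifting) divide_pos_pos norm_minus_commute rangeE zero_less_numeral)
    obtain N where N: "1 / real (Suc N) < \<epsilon> / 20"
      using \<open>\<epsilon> > 0\<close> by (metis divide_pos_pos nat_approx_posE zero_less_numeral)
    have "norm (e n * b - b) < \<epsilon> \<and> norm (b * e n - b) < \<epsilon>" if "n \<ge> max k N" for n
    proof -
      have "1 / real (Suc n) \<le> 1 / real (Suc N)" using that by (simp add: frac_le)
      then have s: "norm (d k - e n * d k) < \<epsilon> / 20" "norm (d k - d k * e n) < \<epsilon> / 20"
        using e[of k n] N that by simp_all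
      have p: "norm (e n) * norm (b - d k) \<le> 8 * (\<epsilon> / 20)"
        using e8[of n] k by (intro mult_mono) auto
      have tri: "norm (x - y - z) \<le> norm x + norm y + norm z" for x y z :: 'b
        using norm_triangle_ineq4[of x y] norm_triangle_ineq4[of "x - y" z] by linarith
      have "norm (e n * b - b) \<le> norm (e n * (b - d k)) + norm (b - d k) + norm (d k - e n * d k)"
        using tri[of "e n * (b - d k)" "b - d k" "d k - e n * d k"] by (simp add: right_diff_distrib)
      moreover have "norm (b * e n - b) \<le> norm ((b - d k) * e n) + norm (b - d k) + norm (d k - d k * e n)"
        using tri[of "(b - d k) * e n" "b - d k" "d k - d k * e n"] by (simp add: left_diff_distrib)
      moreover have "norm (e n * (b - d k)) \<le> 8 * (\<epsilon> / 20)" "norm ((b - d k) * e n) \<le> 8 * (\<epsilon> / 20)"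
        using norm_mult_ineq[of "e n" "b - d k"] norm_mult_ineq[of "b - d k" "e n"] p
        by (simp_all add: mult.commute)
      ultimately show ?thesis using k s \<open>\<epsilon> > 0\<close> by linarith
    qed
    then show ?thesis by (auto simp: eventually_sequentially intro!: exI[of _ "max k N"])
  qed
  define E where "E = abs_seq_alg e"
  have "E * const_seq b = const_seq b" "const_seq b * E = const_seq b" for b
  proof -
    have "(\<lambda>n. e n * b - b) \<longlonglongrightarrow> 0" "(\<lambda>n. b * e n - b) \<longlonglongrightarrow> 0"
      unfolding tendsto_iff dist_norm diff_zero using lim[of _ b] by (blast intro: eventually_mono)+
    then have "seq_rel (\<lambda>n. e n * b) (\<lambda>n. b)" "seq_rel (\<lambda>n. b * e n) (\<lambda>n. b)"
      by (simp_all add: seq_rel_def Bseq_times Be Bseq_const)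
    then show "E * const_seq b = const_seq b" "const_seq b * E = const_seq b"
      using Be by (simp_all add: E_def const_seq.abs_eq times_seq_alg.abs_eq seq_rel_refl Bseq_const abs_seq_alg_eqI)
  qed
  with that show thesis by blast
qed

section \<open>Rokhlin towers\<close>

text \<open>
  Central sequences modulo the annihilator act on the right ideal \<open>S\<close> of the sequence algebra defined
  in the proof, which contains the constant sequences, and the elements \<open>P i\<close> act on it as
  projections, hence as contractions. On the part of \<open>S\<close> that is fixed by \<open>P i\<close>, the maps
  \<open>P i * (1 - P k)\<close> with \<open>k \<noteq> i\<close> are contractions that average to the identity. So each of them is the
  identity there, which says \<open>P i * P k * P i = 0\<close>.
\<close>

lemma central_projections_orthogonal:
  fixes P :: "'i \<Rightarrow> 'b::cstar_algebra seq_alg"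
  assumes fin: "finite I"
    and comm: "\<And>i. i \<in> I \<Longrightarrow> P i \<in> rel_commutant"
    and idem: "\<And>i b. i \<in> I \<Longrightarrow> P i * P i * const_seq b = P i * const_seq b"
    and selfadj: "\<And>i b. i \<in> I \<Longrightarrow> star (P i) * const_seq b = P i * const_seq b"
    and total: "\<And>b. (\<Sum>i\<in>I. P i) * const_seq b = const_seq b"
  shows "i \<in> I \<Longrightarrow> norm (P i * const_seq b) \<le> norm b"
    and "i \<in> I \<Longrightarrow> j \<in> I \<Longrightarrow> i \<noteq> j \<Longrightarrow> P i * P j * const_seq b = 0"
proof -
  define Q where "Q = (\<Sum>i\<in>I. P i)"
  define S where "S = {x. Q * x = x \<and> (\<forall>z\<in>rel_annihilator. z * x = 0)}"
  have Q: "Q \<in> rel_commutant" unfolding Q_def by (intro rel_commutant_sum comm)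
  have cong: "x * s = y * s"
    if "x \<in> rel_commutant" "y \<in> rel_commutant" "\<And>b. x * const_seq b = y * const_seq b" "s \<in> S" for x y s
  proof -
    have "x - y \<in> rel_annihilator"
      using that by (simp add: rel_annihilator_def left_diff_distrib right_diff_distrib rel_commutantD[symmetric])
    then show ?thesis using \<open>s \<in> S\<close> by (auto simp: S_def left_diff_distrib)
  qed
  have mult_S: "x * s \<in> S" if "x \<in> rel_commutant" "s \<in> S" for x s
  proof -
    have "Q * x * const_seq b = x * const_seq b" for b
    proof -
      have "Q * x * const_seq b = Q * const_seq b * x" by (simp add: mult.assoc rel_commutantD that)
      then show ?thesis by (simp add: Q_def total rel_commutantD that)
    qed
    then have "Q * x * s = x * s"
      by (rule cong[OF rel_commutant_closed(4)[OF Q that(1)] that(1) _ that(2)])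
    moreover have "z * x \<in> rel_annihilator" if "z \<in> rel_annihilator" for z
    proof -
      have "z * x * const_seq b = z * const_seq b * x" for b
        by (simp add: mult.assoc rel_commutantD \<open>x \<in> rel_commutant\<close>)
      then show ?thesis using that by (simp add: rel_annihilator_def mult.assoc[symmetric])
    qed
    ultimately show ?thesis using that by (auto simp: S_def mult.assoc[symmetric])
  qed
  have const_S: "const_seq b \<in> S" for b by (auto simp: S_def Q_def total rel_annihilator_def)
  have star_comm: "i \<in> I \<Longrightarrow> star (P i) \<in> rel_commutant" for i
    using rel_commutant_closed(5) comm by blast
  have idem_S: "P i * (P i * s) = P i * s" if "i \<in> I" "s \<in> S" for i s
    unfolding mult.assoc[symmetric]
    by (rule cong[OF rel_commutant_closed(4) comm _ that(2)]) (simp_all add: comm idem that)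
  have selfadj_S: "star (P i) * s = P i * s" if "i \<in> I" "s \<in> S" for i s
    by (rule cong[OF star_comm comm _ that(2)]) (simp_all add: selfadj that)
  have star_P: "star (P i * s) * t = star s * (P i * t)" if "i \<in> I" "t \<in> S" for i s t
    using selfadj_S[OF that] by (simp add: star_mult mult.assoc)
  have contr: "norm (P i * s) \<le> norm s" if "i \<in> I" "s \<in> S" for i s
  proof -
    have "star (P i * s) * (P i * s) = star s * (P i * s)"
      by (simp add: star_P idem_S mult_S comm that)
    then have "norm (P i * s) * norm (P i * s) \<le> norm s * norm (P i * s)"
      using seq_alg_cstar_identity[of "P i * s"] norm_mult_ineq[of "star s" "P i * s"]
        seq_alg_cstar_identity[of s] by (simp add: power2_eq_square norm_star_seq)
    then show ?thesis by (cases "P i * s = 0") auto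
  qed
  have contr': "norm (s - P i * s) \<le> norm s" if "i \<in> I" "s \<in> S" for i s
  proof -
    have "star (s - P i * s) * (s - P i * s) = star s * (s - P i * s)"
      by (simp add: star_diff left_diff_distrib right_diff_distrib star_P idem_S mult_S comm that)
    then have "norm (s - P i * s) * norm (s - P i * s) \<le> norm s * norm (s - P i * s)"
      using seq_alg_cstar_identity[of "s - P i * s"] norm_mult_ineq[of "star s" "s - P i * s"]
      by (simp add: power2_eq_square norm_star_seq)
    then show ?thesis by (cases "s - P i * s = 0") auto
  qed
  have sub: "subspace S"
    by (auto simp: subspace_def S_def distrib_left)
  have diff_S: "s - t \<in> S" if "s \<in> S" "t \<in> S" for s t using subspace_diff[OF sub that] .
  show "i \<in> I \<Longrightarrow> norm (P i * const_seq b) \<le> norm b"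
    using contr const_S norm_const_seq_le order_trans by blast
  have orth: "P j * P i * const_seq b = 0" if ij: "i \<in> I" "j \<in> I" "i \<noteq> j" for i j
  proof -
    define Si where "Si = {s \<in> S. P i * s = s}"
    have "P i * (s - P j * s) = s" if s: "s \<in> Si" for s
    proof (rule average_of_contractions_is_identity[where T = "\<lambda>k x. P i * (x - P k * x)" and S = Si and I = "I - {i}"])
      show "subspace Si" using sub by (auto simp: subspace_def Si_def distrib_left)
      show "finite (I - {i})" "j \<in> I - {i}" "s \<in> Si" using fin ij s by auto
      show "linear (\<lambda>x. P i * (x - P k * x))" for k
        by (rule linearI) (simp_all add: algebra_simps)
      fix k x assume kx: "k \<in> I - {i}" "x \<in> Si"
      then have x: "x - P k * x \<in> S" by (auto simp: Si_def intro: diff_S mult_S comm)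
      show "P i * (x - P k * x) \<in> Si"
        using x ij by (simp add: Si_def mult_S comm idem_S)
      have "norm (P i * (x - P k * x)) \<le> norm (x - P k * x)" using x ij by (intro contr) auto
      also have "\<dots> \<le> norm x" using kx by (intro contr') (auto simp: Si_def)
      finally show "norm (P i * (x - P k * x)) \<le> norm x" .
    next
      fix x assume x: "x \<in> Si"
      have "(\<Sum>k\<in>I - {i}. P k) = Q - P i" using fin ij by (simp add: Q_def sum_diff1)
      then have "(\<Sum>k\<in>I - {i}. P k * x) = 0"
        using x by (simp add: sum_distrib_right[symmetric] Si_def S_def left_diff_distrib)
      moreover have "(\<Sum>k\<in>I - {i}. P i * (x - P k * x))
          = P i * ((\<Sum>k\<in>I - {i}. x) - (\<Sum>k\<in>I - {i}. P k * x))"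
        by (simp add: sum_distrib_left sum_subtractf right_diff_distrib)
      ultimately show "(\<Sum>k\<in>I - {i}. P i * (x - P k * x)) = real (card (I - {i})) *\<^sub>R x"
        using x by (simp add: Si_def sum_constant_scaleR)
    qed
    then have PiPj: "P i * (P j * s) = 0" if "s \<in> Si" for s
      using that by (simp add: Si_def right_diff_distrib)
    define s where "s = P i * const_seq b"
    have s: "s \<in> Si" using ij by (simp add: s_def Si_def mult_S comm const_S idem_S)
    have "star (P j * s) * (P j * s) = star s * (P j * s)"
      using s ij by (simp add: star_P idem_S mult_S comm Si_def)
    also have "\<dots> = star (const_seq b) * (P i * (P j * s))"
      using s ij unfolding s_def by (intro star_P) (auto simp: mult_S comm const_S)
    also have "\<dots> = 0" using PiPj[OF s] by simp
    finally have "P j * s = 0" using seq_alg_cstar_identity[of "P j * s"] by simp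
    then show ?thesis by (simp add: s_def mult.assoc)
  qed
  show "P i * P j * const_seq b = 0" if ji: "i \<in> I" "j \<in> I" "i \<noteq> j"
    using orth[OF ji(2,1)] ji(3) by simp
qed

text \<open>
  Lifts to the sequence algebra of the translates of a Rokhlin projection. The relations of
  projections hold only modulo the annihilator, that is, after multiplication by constants.
\<close>

locale rokhlin_tower = group G for G (structure) +
  fixes \<beta> :: "'g \<Rightarrow> 'b::cstar_algebra star_aut" and P :: "'g \<Rightarrow> 'b seq_alg"
  assumes finite_G: "finite (carrier G)"
    and commutant: "\<And>h. h \<in> carrier G \<Longrightarrow> P h \<in> rel_commutant"
    and idem: "\<And>h b. h \<in> carrier G \<Longrightarrow> P h * P h * const_seq b = P h * const_seq b"
    and selfadj: "\<And>h b. h \<in> carrier G \<Longrightarrow> star (P h) * const_seq b = P h * const_seq b"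
    and total: "\<And>b. (\<Sum>h\<in>carrier G. P h) * const_seq b = const_seq b"
    and shift: "\<And>g h b. g \<in> carrier G \<Longrightarrow> h \<in> carrier G \<Longrightarrow>
      aut_seq (\<beta> g) (P h) * const_seq b = P (g \<otimes> h) * const_seq b"
begin

lemma norm_P_le: "h \<in> carrier G \<Longrightarrow> norm (P h * const_seq b) \<le> norm b"
  and orthogonal: "h \<in> carrier G \<Longrightarrow> k \<in> carrier G \<Longrightarrow> h \<noteq> k \<Longrightarrow> P h * P k * const_seq b = 0"
  using central_projections_orthogonal[OF finite_G commutant idem selfadj total] by blast+

definition glue :: "('g \<Rightarrow> 'b) \<Rightarrow> 'b seq_alg"
  where "glue w = (\<Sum>h\<in>carrier G. P h * const_seq (w h))"

lemma star_glue: "star (glue w) = glue (\<lambda>h. star (w h))"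
proof -
  have star_sum: "star (sum x I) = (\<Sum>i\<in>I. star (x i :: 'b seq_alg))" for x and I :: "'g set"
    by (induction I rule: infinite_finite_induct) (auto simp: star_add)
  have "star (P h * const_seq b) = P h * const_seq (star b)" if "h \<in> carrier G" for h b
  proof -
    have "star (P h) \<in> rel_commutant" using rel_commutant_closed(5) commutant that by blast
    then have "star (P h * const_seq b) = star (P h) * const_seq (star b)"
      by (simp add: star_mult star_const_seq rel_commutantD)
    then show ?thesis by (simp add: selfadj that)
  qed
  then show ?thesis by (simp add: glue_def star_sum)
qed

lemma aut_glue:
  assumes g: "g \<in> carrier G"
  shows "aut_seq (\<beta> g) (glue w) = (\<Sum>h\<in>carrier G. P (g \<otimes> h) * const_seq (aut_app (\<beta> g) (w h)))"
  using g by (simp add: glue_def aut_seq_sum aut_seq_mult aut_seq_const_seq shift)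

text \<open>
  The effect of the shift: \<open>\<beta> g\<close> carries the summand with index \<open>h\<close> under \<open>P (g h)\<close>, where
  orthogonality selects the summand of the second factor with index \<open>g h\<close>.
\<close>

lemma glue_sandwich:
  assumes g: "g \<in> carrier G"
  shows "aut_seq (\<beta> g) (glue w') * const_seq c * glue w
    = (\<Sum>h\<in>carrier G. P (g \<otimes> h) * const_seq (aut_app (\<beta> g) (w' h) * c * w (g \<otimes> h)))"
proof -
  have "P (g \<otimes> h) * const_seq (aut_app (\<beta> g) (w' h)) * const_seq c * glue w
      = P (g \<otimes> h) * const_seq (aut_app (\<beta> g) (w' h) * c * w (g \<otimes> h))" if h: "h \<in> carrier G" for h
  proof -
    let ?y = "aut_app (\<beta> g) (w' h) * c"
    have gh: "g \<otimes> h \<in> carrier G" using g h by simp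
    have "P (g \<otimes> h) * const_seq ?y * (P k * const_seq (w k)) = P (g \<otimes> h) * P k * const_seq (?y * w k)"
      if "k \<in> carrier G" for k
    proof -
      have "P (g \<otimes> h) * const_seq ?y * (P k * const_seq (w k)) = P (g \<otimes> h) * (const_seq ?y * P k) * const_seq (w k)"
        by (simp only: mult.assoc)
      also have "const_seq ?y * P k = P k * const_seq ?y"
        by (simp add: rel_commutantD commutant that)
      finally show ?thesis by (simp only: const_seq_mult mult.assoc)
    qed
    then have "P (g \<otimes> h) * const_seq ?y * glue w = (\<Sum>k\<in>carrier G. P (g \<otimes> h) * P k * const_seq (?y * w k))"
      by (simp add: glue_def sum_distrib_left)
    also have "\<dots> = (\<Sum>k\<in>carrier G. if k = g \<otimes> h then P (g \<otimes> h) * const_seq (?y * w k) else 0)"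
      by (intro sum.cong refl) (auto simp: idem orthogonal gh)
    also have "\<dots> = P (g \<otimes> h) * const_seq (?y * w (g \<otimes> h))"
      using gh finite_G by simp
    finally show ?thesis by (simp add: const_seq_mult mult.assoc)
  qed
  then show ?thesis by (simp add: aut_glue[OF g] sum_distrib_right)
qed

lemma norm_glue_sandwich_le:
  assumes g: "g \<in> carrier G"
  shows "norm (aut_seq (\<beta> g) (glue w') * const_seq c * glue w - const_seq t)
    \<le> (\<Sum>h\<in>carrier G. norm (aut_app (\<beta> g) (w' h) * c * w (g \<otimes> h) - t))"
proof -
  have "bij_betw (\<lambda>h. g \<otimes> h) (carrier G) (carrier G)"
    using g by (intro bij_betwI[where g = "\<lambda>h. inv g \<otimes> h"]) (auto simp: m_assoc[symmetric])
  then have "(\<Sum>h\<in>carrier G. P (g \<otimes> h) * const_seq t) = (\<Sum>h\<in>carrier G. P h * const_seq t)"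
    by (rule sum.reindex_bij_betw)
  also have "\<dots> = const_seq t" using total by (simp add: sum_distrib_right)
  finally have "aut_seq (\<beta> g) (glue w') * const_seq c * glue w - const_seq t
    = (\<Sum>h\<in>carrier G. P (g \<otimes> h) * const_seq (aut_app (\<beta> g) (w' h) * c * w (g \<otimes> h) - t))"
    by (simp add: glue_sandwich[OF g] const_seq_diff right_diff_distrib sum_subtractf)
  then show ?thesis using g by (auto intro!: sum_norm_le norm_P_le)
qed

end

text \<open>
  All relations of the projection lift directly, except for the sum: that the sum of the translates
  is a unit of the central sequence algebra says nothing about constants until it is applied to the
  class of a sequential unit.
\<close>

lemma rokhlin_tower_exists:
  fixes G (structure) and \<beta> :: "'g \<Rightarrow> 'b::cstar_algebra star_aut"
  assumes grp: "group G" and fin: "finite (carrier G)" and sep: "separable_space (euclidean :: 'b topology)"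
    and act: "anomalous_action G \<beta> v" and rok: "rokhlin_property G \<beta>"
  obtains P where "rokhlin_tower G \<beta> P"
proof -
  interpret group G by (rule grp)
  obtain p where p: "projection p" and unit: "is_unit_element (\<Sum>g\<in>carrier G. aut_central (\<beta> g) p)"
    using rok by (auto simp: rokhlin_property_def)
  \<comment> \<open>a representing central sequence of the Rokhlin projection\<close>
  define Q where "Q = rep_central_seq_alg p"
  have QQ: "central_rel Q Q" and pQ: "p = abs_central_seq_alg Q"
    unfolding Q_def by (simp_all add: Quotient3_rep_reflp[OF Quotient3_central_seq_alg]
        Quotient3_abs_rep[OF Quotient3_central_seq_alg])
  have Q: "Q \<in> rel_commutant" using QQ by (simp add: central_rel_def)
  have refl: "central_rel x x \<longleftrightarrow> x \<in> rel_commutant" for x :: "'b seq_alg"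
    by (auto simp: central_rel_iff)
  have absD: "x * const_seq b = y * const_seq b"
    if "abs_central_seq_alg x = abs_central_seq_alg y" "x \<in> rel_commutant" "y \<in> rel_commutant" for x y :: "'b seq_alg" and b
    using Quotient3_rel[OF Quotient3_central_seq_alg, of x y] that refl by (simp add: central_rel_iff)
  define P where "P h = aut_seq (\<beta> h) Q" for h
  have P: "P h \<in> rel_commutant" for h unfolding P_def by (rule aut_seq_rel_commutant[OF Q])
  have Q_star: "star Q \<in> rel_commutant" using rel_commutant_closed(5) Q by blast
  have idem_Q: "Q * Q * const_seq b = Q * const_seq b" for b
    using p Q by (intro absD) (auto simp: projection_def pQ times_central_seq_alg.abs_eq[symmetric] QQ rel_commutant_closed)
  have selfadj_Q: "star Q * const_seq b = Q * const_seq b" for b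
    using p Q Q_star by (intro absD) (auto simp: projection_def pQ star_central_seq_alg.abs_eq[symmetric] QQ)
  have lift: "x' * const_seq b = y' * const_seq b"
    if "\<And>b. x * const_seq b = y * const_seq b" "x' = aut_seq f x" "y' = aut_seq f y" for x y x' y' :: "'b seq_alg" and b f
  proof -
    obtain b' where "aut_app f b' = b" by (rule aut_app_surj)
    then show ?thesis using that by (metis aut_seq_const_seq aut_seq_mult)
  qed
  obtain E :: "'b seq_alg" where E: "\<And>b. E * const_seq b = const_seq b" "\<And>b. const_seq b * E = const_seq b"
    using sequential_unit[OF sep] by blast
  then have E_comm: "E \<in> rel_commutant" by (simp add: rel_commutant_def)
  have sum_abs: "(\<Sum>h\<in>I. aut_central (\<beta> h) p) = abs_central_seq_alg (\<Sum>h\<in>I. P h)" for I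
  proof (induction I rule: infinite_finite_induct)
    case (insert h I)
    then show ?case
      by (simp add: pQ aut_central.abs_eq P_def[symmetric] plus_central_seq_alg.abs_eq refl P Q rel_commutant_sum)
  qed (simp_all add: zero_central_seq_alg.abs_eq)
  have "rokhlin_tower G \<beta> P"
  proof
    show "finite (carrier G)" by (rule fin)
    show "P h \<in> rel_commutant" for h by (rule P)
    show "P h * P h * const_seq b = P h * const_seq b" for h b
      by (rule lift[OF idem_Q]) (simp_all add: P_def aut_seq_mult)
    show "star (P h) * const_seq b = P h * const_seq b" for h b
      by (rule lift[OF selfadj_Q]) (simp_all add: P_def aut_seq_star)
    show "(\<Sum>h\<in>carrier G. P h) * const_seq b = const_seq b" for b
    proof -
      let ?S = "\<Sum>h\<in>carrier G. P h"
      have S: "?S \<in> rel_commutant" by (intro rel_commutant_sum P)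
      have "abs_central_seq_alg (?S * E) = abs_central_seq_alg E"
        using unit unfolding sum_abs is_unit_element_def
        by (simp add: times_central_seq_alg.abs_eq[symmetric] refl S E_comm)
      then have "?S * E * const_seq b = E * const_seq b"
        by (rule absD) (simp_all add: S E_comm rel_commutant_closed)
      then show ?thesis by (simp add: mult.assoc E)
    qed
    show "aut_seq (\<beta> g) (P h) * const_seq b = P (g \<otimes> h) * const_seq b"
      if "g \<in> carrier G" "h \<in> carrier G" for g h b
      unfolding P_def using act that
      by (intro aut_seq_compose_Ad[OF _ Q, of _ _ "v g h"]) (auto simp: anomalous_action_def)
  qed
  with that show thesis by blast
qed

section \<open>The intertwining element\<close>

context anomalous_pair
begin

text \<open>
  The element \<open>(s h)\<^sup>* * \<beta> h x * t h\<close> of the introduction, with the approximate unit \<open>e\<close> in the place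
  of a unit.
\<close>

definition transport :: "('g \<Rightarrow> 'a \<Rightarrow> 'b) \<Rightarrow> ('g \<Rightarrow> 'a \<Rightarrow> 'b) \<Rightarrow> 'a \<Rightarrow> 'b \<Rightarrow> 'g \<Rightarrow> 'b"
  where "transport \<phi> \<psi> e x h = star (\<phi> h e) * aut_app (\<beta> h) x * \<psi> h e"

lemma star_transport: "star (transport \<phi> \<psi> e x h) = transport \<psi> \<phi> e (star x) h"
  by (simp add: transport_def star_mult star_star aut_app_star mult.assoc)

text \<open>
  Let \<open>T y\<close> be the expression in the proof. Coherence of \<open>\<phi>\<close> and the outer product relation identify
  the sandwich with \<open>T (x\<^sup>* * \<phi> \<one> c * x)\<close>, while coherence of \<open>\<psi>\<close> evaluates \<open>T (\<psi> \<one> c)\<close> to a value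
  of \<open>\<psi> g\<close>. Both identities are exact, so the error is controlled by the difference of the arguments
  of \<open>T\<close>.
\<close>

lemma norm_transport_le:
  assumes "coherent_map G \<alpha> u \<beta> v \<phi>" and "coherent_map G \<alpha> u \<beta> v \<psi>"
    and g: "g \<in> carrier G" and h: "h \<in> carrier G"
    and c: "aut_app (\<alpha> (g \<otimes> h)) c = lmul (star (u g h)) (aut_app (\<alpha> g) e * a) * star e"
  shows "norm (aut_app (\<beta> g) (star (transport \<phi> \<psi> e x h)) * \<phi> g a * transport \<phi> \<psi> e x (g \<otimes> h)
      - \<psi> g (aut_app (\<alpha> g) (star e * e) * a * (star e * e)))
    \<le> (norm e)\<^sup>2 * norm (star x * \<phi> \<one> c * x - \<psi> \<one> c)"
proof -
  interpret phi: coherent_map G \<alpha> u \<beta> v \<phi> by fact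
  interpret psi: coherent_map G \<alpha> u \<beta> v \<psi> by fact
  let ?k = "g \<otimes> h"
  have k: "?k \<in> carrier G" using g h by simp
  define d where "d = lmul (star (u g h)) (aut_app (\<alpha> g) e * a)"
  define T where "T y = star (aut_app (\<beta> g) (\<psi> h e)) * lmul (v g h) (aut_app (\<beta> ?k) y * \<psi> ?k e)" for y
  have "aut_app (\<beta> g) (star (transport \<phi> \<psi> e x h)) * \<phi> g a * transport \<phi> \<psi> e x ?k
      = star (aut_app (\<beta> g) (\<psi> h e)) * (aut_app (\<beta> g) (aut_app (\<beta> h) (star x))
          * (aut_app (\<beta> g) (\<phi> h e) * \<phi> g a) * star (\<phi> ?k e) * aut_app (\<beta> ?k) x * \<psi> ?k e)"
    by (simp add: transport_def star_mult star_star aut_app_mult aut_app_star mult.assoc)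
  also have "aut_app (\<beta> g) (\<phi> h e) * \<phi> g a = lmul (v g h) (\<phi> ?k d)"
    by (simp add: phi.compose_lmul g h d_def)
  also have "aut_app (\<beta> g) (aut_app (\<beta> h) (star x)) * lmul (v g h) (\<phi> ?k d) * star (\<phi> ?k e) * aut_app (\<beta> ?k) x * \<psi> ?k e
      = lmul (v g h) (aut_app (\<beta> ?k) (star x) * (\<phi> ?k d * star (\<phi> ?k e)) * aut_app (\<beta> ?k) x * \<psi> ?k e)"
    by (simp add: \<beta>_\<beta>_lmul g h lmul_mult[symmetric] mult.assoc)
  also have "\<phi> ?k d * star (\<phi> ?k e) = aut_app (\<beta> ?k) (\<phi> \<one> c)"
    by (rule phi.outer_product[OF k]) (simp add: c d_def)
  finally have 1: "aut_app (\<beta> g) (star (transport \<phi> \<psi> e x h)) * \<phi> g a * transport \<phi> \<psi> e x ?k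
      = T (star x * \<phi> \<one> c * x)"
    by (simp add: T_def aut_app_mult)
  have "aut_app (\<beta> ?k) (\<psi> \<one> c) * \<psi> ?k e = \<psi> ?k (lmul (star (u g h)) (aut_app (\<alpha> g) e * (a * (star e * e))))"
    by (simp add: psi.left_module k c lmul_mult[symmetric] mult.assoc)
  then have "T (\<psi> \<one> c) = star (aut_app (\<beta> g) (\<psi> h e)) * aut_app (\<beta> g) (\<psi> h e) * \<psi> g (a * (star e * e))"
    by (simp add: T_def psi.compose_lmul[symmetric] g h mult.assoc)
  also have "star (aut_app (\<beta> g) (\<psi> h e)) * aut_app (\<beta> g) (\<psi> h e) = aut_app (\<beta> g) (\<psi> \<one> (star e * e))"
    by (simp add: aut_app_star[symmetric] aut_app_mult[symmetric] psi.inner_product h)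
  finally have 2: "T (\<psi> \<one> c) = \<psi> g (aut_app (\<alpha> g) (star e * e) * a * (star e * e))"
    by (simp add: psi.left_module g mult.assoc)
  have "T y - T z = star (aut_app (\<beta> g) (\<psi> h e)) * lmul (v g h) (aut_app (\<beta> ?k) (y - z) * \<psi> ?k e)" for y z
    by (simp add: T_def right_diff_distrib[symmetric] lmul_diff[symmetric] left_diff_distrib[symmetric] aut_app_diff)
  then have "norm (T y - T z) \<le> norm (\<psi> h e) * (norm (y - z) * norm (\<psi> ?k e))" for y z
    using norm_mult_ineq[of "star (aut_app (\<beta> g) (\<psi> h e))" "lmul (v g h) (aut_app (\<beta> ?k) (y - z) * \<psi> ?k e)"]
      mult_left_mono[OF norm_mult_ineq[of "aut_app (\<beta> ?k) (y - z)" "\<psi> ?k e"], of "norm (\<psi> h e)"]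
    by (simp add: norm_star norm_lmul_unitary v_unitary g h)
  moreover have "norm (\<psi> h e) * (r * norm (\<psi> ?k e)) \<le> norm e * (r * norm e)" if "r \<ge> 0" for r
    using that psi.norm_le[OF h, of e] psi.norm_le[OF k, of e] by (intro mult_mono) auto
  ultimately have "norm (T y - T z) \<le> norm e * (norm (y - z) * norm e)" for y z
    using order_trans norm_ge_zero by blast
  then show ?thesis unfolding 1 2[symmetric] by (simp add: power2_eq_square mult.assoc mult.commute)
qed

text \<open>
  The element \<open>e\<close> has to be an approximate unit for \<open>a\<close> and for its preimage under \<open>\<alpha> g\<close>. With
  \<open>norm e \<le> 8\<close> and \<open>e\<close> fixing both up to \<open>\<eta>\<close>, the error is at most \<open>(8\<^sup>2 + 1) * 9 * \<eta>\<close>, which is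
  below \<open>600 * \<eta>\<close>.
\<close>

lemma approximate_unit_compression:
  assumes "finite F" and "finite K" and "\<epsilon> > 0"
  obtains e where "\<And>a g. a \<in> F \<Longrightarrow> g \<in> K \<Longrightarrow>
    norm (aut_app (\<alpha> g) (star e * e) * a * (star e * e) - a) < \<epsilon>"
proof -
  let ?F = "F \<union> (\<lambda>(g, a). inv_into UNIV (aut_app (\<alpha> g)) a) ` (K \<times> F)"
  have "finite ?F" "\<epsilon> / 600 > 0" using assms by auto
  then obtain e where e: "star e = e" "norm e \<le> 8"
    "\<And>b. b \<in> ?F \<Longrightarrow> norm (b - e * b) \<le> \<epsilon> / 600" "\<And>b. b \<in> ?F \<Longrightarrow> norm (b - b * e) \<le> \<epsilon> / 600"
    by (rule approximate_unit) blast
  have "norm (aut_app (\<alpha> g) (star e * e) * a * (star e * e) - a) < \<epsilon>" if a: "a \<in> F" and g: "g \<in> K" for a g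
  proof -
    define a' where "a' = inv_into UNIV (aut_app (\<alpha> g)) a"
    have a': "aut_app (\<alpha> g) a' = a" by (simp add: a'_def bij_is_surj[OF aut_app_bij] surj_f_inv_f)
    have "a' \<in> ?F" using a g by (force simp: a'_def)
    have ee: "norm (b - e * (e * b)) \<le> 9 * (\<epsilon> / 600) \<and> norm (b - b * e * e) \<le> 9 * (\<epsilon> / 600)" if "b \<in> ?F" for b
    proof -
      have "norm (b - e * (e * b)) \<le> norm (b - e * b) + norm (e * (b - e * b))"
        using norm_triangle_ineq[of "b - e * b" "e * (b - e * b)"] by (simp add: right_diff_distrib)
      moreover have "norm (b - b * e * e) \<le> norm (b - b * e) + norm ((b - b * e) * e)"
        using norm_triangle_ineq[of "b - b * e" "(b - b * e) * e"] by (simp add: left_diff_distrib)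
      moreover have "norm (e * (b - e * b)) \<le> 8 * (\<epsilon> / 600)"
        using norm_mult_ineq[of e "b - e * b"] mult_mono[OF e(2) e(3)[OF that]] by simp
      moreover have "norm ((b - b * e) * e) \<le> (\<epsilon> / 600) * 8"
        using norm_mult_ineq[of "b - b * e" e] mult_mono[OF e(4)[OF that] e(2)] \<open>\<epsilon> > 0\<close> by simp
      ultimately show ?thesis using e(3,4)[OF that] by linarith
    qed
    have n64: "norm (e * e) \<le> 64" using norm_mult_ineq[of e e] mult_mono[OF e(2) e(2)] by simp
    let ?E = "aut_app (\<alpha> g) (e * e)"
    have "?E * a * (e * e) - a = - (?E * (a - a * e * e)) - aut_app (\<alpha> g) (a' - e * (e * a'))"
      by (simp add: a' aut_app_diff aut_app_mult algebra_simps)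
    also have "norm \<dots> \<le> norm (?E * (a - a * e * e)) + norm (a' - e * (e * a'))"
      using norm_triangle_ineq4[of "- (?E * (a - a * e * e))" "aut_app (\<alpha> g) (a' - e * (e * a'))"] by simp
    also have "norm (?E * (a - a * e * e)) \<le> 64 * (9 * (\<epsilon> / 600))"
      using norm_mult_ineq[of ?E "a - a * e * e"] mult_mono[OF n64, of "norm (a - a * e * e)" "9 * (\<epsilon> / 600)"] ee[of a] a
      by simp
    finally show ?thesis using ee[OF \<open>a' \<in> ?F\<close>] \<open>\<epsilon> > 0\<close> e(1) by simp
  qed
  with that show thesis by blast
qed

end

theorem proposition3p1:
  fixes G :: "('g, 'm) monoid_scheme"
    and \<alpha> :: "'g \<Rightarrow> 'a::cstar_algebra star_aut" and u :: "'g \<Rightarrow> 'g \<Rightarrow> 'a multiplier"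
    and \<beta> :: "'g \<Rightarrow> 'b::cstar_algebra star_aut" and v :: "'g \<Rightarrow> 'g \<Rightarrow> 'b multiplier"
    and \<omega> :: "'g \<Rightarrow> 'g \<Rightarrow> 'g \<Rightarrow> complex"
    and \<phi> \<psi> :: "'g \<Rightarrow> 'a \<Rightarrow> 'b"
  assumes "group G" and "finite (carrier G)"
    and "separable_space (euclidean :: 'a topology)"
    and "separable_space (euclidean :: 'b topology)"
    and "anomalous_action G \<alpha> u" and "anomalous_action G \<beta> v"
    and "has_anomaly G \<alpha> u \<omega>" and "has_anomaly G \<beta> v \<omega>"
    and "rokhlin_property G \<beta>"
    and "coherent_morphism G \<alpha> u \<beta> v \<phi>" and "coherent_morphism G \<alpha> u \<beta> v \<psi>"
    and "approx_MvN (\<phi> \<one>\<^bsub>G\<^esub>) (\<psi> \<one>\<^bsub>G\<^esub>)"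
  shows "approx_MvN_coherent G \<beta> \<phi> \<psi>"
  unfolding approx_MvN_coherent_def
proof (intro allI impI, elim conjE)
  fix \<epsilon> :: real and K :: "'g set" and F :: "'a set"
  assume \<epsilon>: "\<epsilon> > 0" and K: "finite K" "K \<subseteq> carrier G" and F: "finite F"
  interpret group G by fact
  interpret anomalous_pair G \<alpha> u \<beta> v by unfold_locales fact+
  interpret phi: coherent_map G \<alpha> u \<beta> v \<phi> by unfold_locales fact
  interpret psi: coherent_map G \<alpha> u \<beta> v \<psi> by unfold_locales fact
  obtain P where "rokhlin_tower G \<beta> P"
    by (rule rokhlin_tower_exists[OF assms(1,2,4,6,9)])
  then interpret rokhlin_tower G \<beta> P .
  define \<delta> where "\<delta> = \<epsilon> / (3 * real (card (carrier G)))"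
  have card: "real (card (carrier G)) > 0" using finite_G one_closed by (metis card_gt_0_iff empty_iff of_nat_0_less_iff)
  have \<delta>: "\<delta> > 0" using \<epsilon> card by (simp add: \<delta>_def)
  obtain e where e: "\<And>a g. a \<in> F \<Longrightarrow> g \<in> carrier G \<Longrightarrow>
      norm (aut_app (\<alpha> g) (star e * e) * a * (star e * e) - a) < \<delta>"
    using approximate_unit_compression[OF F finite_G \<delta>] by blast
  \<comment> \<open>the arguments at which the equivalence of \<open>\<phi> \<one>\<close> and \<open>\<psi> \<one>\<close> is used; they depend on \<open>e\<close>\<close>
  define c where "c g h a = inv_into UNIV (aut_app (\<alpha> (g \<otimes>\<^bsub>G\<^esub> h))) (lmul (star (u g h)) (aut_app (\<alpha> g) e * a) * star e)" for g h a
  have c: "aut_app (\<alpha> (g \<otimes>\<^bsub>G\<^esub> h)) (c g h a) = lmul (star (u g h)) (aut_app (\<alpha> g) e * a) * star e" for g h a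
    by (simp add: c_def bij_is_surj[OF aut_app_bij] surj_f_inv_f)
  define C where "C = (\<lambda>(g, h, a). c g h a) ` (carrier G \<times> carrier G \<times> F)"
  have "finite C" using F finite_G by (simp add: C_def)
  moreover have "\<delta> / ((norm e)\<^sup>2 + 1) > 0" using \<delta> by (intro divide_pos_pos) (auto simp: add_nonneg_pos)
  ultimately obtain x where x: "\<And>b. b \<in> C \<Longrightarrow> norm (star x * \<phi> \<one>\<^bsub>G\<^esub> b * x - \<psi> \<one>\<^bsub>G\<^esub> b) < \<delta> / ((norm e)\<^sup>2 + 1)"
      "\<And>b. b \<in> C \<Longrightarrow> norm (x * \<psi> \<one>\<^bsub>G\<^esub> b * star x - \<phi> \<one>\<^bsub>G\<^esub> b) < \<delta> / ((norm e)\<^sup>2 + 1)"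
    using \<open>approx_MvN (\<phi> \<one>\<^bsub>G\<^esub>) (\<psi> \<one>\<^bsub>G\<^esub>)\<close> unfolding approx_MvN_def by blast
  \<comment> \<open>stated for both directions: the second one exchanges \<open>\<phi>\<close> with \<open>\<psi>\<close> and \<open>x\<close> with \<open>star x\<close>\<close>
  have piece: "norm (aut_app (\<beta> g) (star (transport \<phi>' \<psi>' e x' h)) * \<phi>' g a * transport \<phi>' \<psi>' e x' (g \<otimes>\<^bsub>G\<^esub> h) - \<psi>' g a) \<le> 2 * \<delta>"
    if "coherent_map G \<alpha> u \<beta> v \<phi>'" "coherent_map G \<alpha> u \<beta> v \<psi>'" and g: "g \<in> carrier G" and h: "h \<in> carrier G" and a: "a \<in> F"
      and x': "\<And>b. b \<in> C \<Longrightarrow> norm (star x' * \<phi>' \<one>\<^bsub>G\<^esub> b * x' - \<psi>' \<one>\<^bsub>G\<^esub> b) < \<delta> / ((norm e)\<^sup>2 + 1)"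
    for \<phi>' \<psi>' x' g h a
  proof -
    interpret psi': coherent_map G \<alpha> u \<beta> v \<psi>' by fact
    have "c g h a \<in> C" using g h a by (force simp: C_def)
    then have "(norm e)\<^sup>2 * norm (star x' * \<phi>' \<one>\<^bsub>G\<^esub> (c g h a) * x' - \<psi>' \<one>\<^bsub>G\<^esub> (c g h a))
        \<le> ((norm e)\<^sup>2 + 1) * (\<delta> / ((norm e)\<^sup>2 + 1))"
      using x'[of "c g h a"] by (intro mult_mono) auto
    also have "\<dots> = \<delta>" by (simp add: add_nonneg_eq_0_iff)
    finally have 1: "norm (aut_app (\<beta> g) (star (transport \<phi>' \<psi>' e x' h)) * \<phi>' g a * transport \<phi>' \<psi>' e x' (g \<otimes>\<^bsub>G\<^esub> h)
      - \<psi>' g (aut_app (\<alpha> g) (star e * e) * a * (star e * e))) \<le> \<delta>"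
      using norm_transport_le[OF that(1,2) g h c[of g h a], of x'] by linarith
    have "norm (\<psi>' g (aut_app (\<alpha> g) (star e * e) * a * (star e * e)) - \<psi>' g a)
        \<le> norm (aut_app (\<alpha> g) (star e * e) * a * (star e * e) - a)"
      using psi'.norm_le[OF g] clinear_diff[OF psi'.lin[OF g]] by metis
    then have 2: "norm (\<psi>' g (aut_app (\<alpha> g) (star e * e) * a * (star e * e)) - \<psi>' g a) \<le> \<delta>"
      using e[OF a g] by linarith
    show ?thesis using norm_diff_triangle_le[OF 1 2] by simp
  qed
  define w where "w = transport \<phi> \<psi> e x"
  have sum_less: "(\<Sum>h\<in>carrier G. f h) < \<epsilon>" if "\<And>h. h \<in> carrier G \<Longrightarrow> f h \<le> 2 * \<delta>" for f :: "'g \<Rightarrow> real"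
  proof -
    have "(\<Sum>h\<in>carrier G. f h) \<le> real (card (carrier G)) * (2 * \<delta>)" using that by (intro sum_bounded_above)
    also have "\<dots> < \<epsilon>" using card \<epsilon> by (simp add: \<delta>_def)
    finally show ?thesis .
  qed
  have phi_psi: "norm (aut_seq (\<beta> g) (star (glue w)) * const_seq (\<phi> g a) * glue w - const_seq (\<psi> g a)) < \<epsilon>"
    if g: "g \<in> K" and a: "a \<in> F" for g a
  proof -
    have g: "g \<in> carrier G" using g K by blast
    show ?thesis unfolding star_glue
      by (rule le_less_trans[OF norm_glue_sandwich_le[OF g] sum_less])
         (unfold w_def, rule piece[OF phi.coherent_map_axioms psi.coherent_map_axioms g _ a x(1)])
  qed
  have psi_phi: "norm (aut_seq (\<beta> g) (glue w) * const_seq (\<psi> g a) * star (glue w) - const_seq (\<phi> g a)) < \<epsilon>"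
    if g: "g \<in> K" and a: "a \<in> F" for g a
  proof -
    have g: "g \<in> carrier G" using g K by blast
    have w: "w = (\<lambda>h. star (transport \<psi> \<phi> e (star x) h))"
      by (simp add: w_def star_transport star_star fun_eq_iff)
    have sw: "(\<lambda>h. star (w h)) = transport \<psi> \<phi> e (star x)" by (simp add: w star_star)
    show ?thesis unfolding star_glue sw
    proof (rule le_less_trans[OF norm_glue_sandwich_le[OF g] sum_less])
      fix h assume "h \<in> carrier G"
      then show "norm (aut_app (\<beta> g) (w h) * \<psi> g a * transport \<psi> \<phi> e (star x) (g \<otimes>\<^bsub>G\<^esub> h) - \<phi> g a) \<le> 2 * \<delta>"
        unfolding w using x(2)
        by (intro piece[OF psi.coherent_map_axioms phi.coherent_map_axioms g _ a]) (simp_all add: star_star)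
    qed
  qed
  obtain W where W: "Bseq W" "glue w = abs_seq_alg W" by (rule seq_alg_cases)
  have B: "Bseq (\<lambda>n. star (W n))" "\<And>f. Bseq (\<lambda>n. aut_app f (W n))" "\<And>f. Bseq (\<lambda>n. aut_app f (star (W n)))"
    using W(1) Bseq_linear[OF bounded_linear_star] Bseq_linear[OF star_hom_bounded_linear[OF aut_app_hom]] by blast+
  note abs_eqs = aut_seq_abs star_seq_alg.abs_eq times_seq_alg.abs_eq const_seq.abs_eq seq_rel_refl Bseq_times Bseq_const B W(1)
  have ev: "\<forall>\<^sub>F n in sequentially. norm (aut_app (\<beta> g) (star (W n)) * \<phi> g a * W n - \<psi> g a) < \<epsilon> \<and>
      norm (aut_app (\<beta> g) (W n) * \<psi> g a * star (W n) - \<phi> g a) < \<epsilon>" if "g \<in> K" "a \<in> F" for g a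
    using phi_psi[OF that] psi_phi[OF that]
    by (intro eventually_conj eventually_norm_less)
       (simp_all add: W(2) abs_eqs abs_seq_alg_diff Bseq_diff)
  have "\<forall>\<^sub>F n in sequentially. \<forall>g\<in>K. \<forall>a\<in>F. norm (aut_app (\<beta> g) (star (W n)) * \<phi> g a * W n - \<psi> g a) < \<epsilon> \<and>
      norm (aut_app (\<beta> g) (W n) * \<psi> g a * star (W n) - \<phi> g a) < \<epsilon>"
    using K(1) F ev by (simp add: eventually_ball_finite)
  then show "\<exists>v. \<forall>g\<in>K. \<forall>a\<in>F. norm (aut_app (\<beta> g) (star v) * \<phi> g a * v - \<psi> g a) < \<epsilon> \<and>
      norm (aut_app (\<beta> g) v * \<psi> g a * star v - \<phi> g a) < \<epsilon>"
    using eventually_happens' sequentially_bot by fastforce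
qed

end
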